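(* Let $\mathcal E:0\to\mathfrak h\xrightarrow{i}\hat{\mathfrak g}\xrightarrow{p}\mathfrak g\to0$ be a non-abelian extension of Lie-Yamaguti algebras of $\mathfrak g$ by $\mathfrak h$ with a section $s$ of $p$. Then there is an exact sequence $$1\longrightarrow\mathrm{Aut}^{\mathfrak g}_{\mathfrak h}(\hat{\mathfrak g})\xrightarrow{H}\mathrm{Aut}_{\mathfrak h}(\hat{\mathfrak g})\xrightarrow{K}\mathrm{Aut}(\mathfrak g)\times\mathrm{Aut}(\mathfrak h)\xrightarrow{W}H^{(2,3)}_{nab}(\mathfrak g,\mathfrak h),$$ where $\mathrm{Aut}^{\mathfrak g}_{\mathfrak h}(\hat{\mathfrak g})=\{\gamma\in\mathrm{Aut}_{\mathfrak h}(\hat{\mathfrak g})\mid K(\gamma)=(I_{\mathfrak g},I_{\mathfrak h})\}$, $H$ is the inclusion, $K(\gamma)=(p\gamma s,\gamma|_{\mathfrak h})$, and $W$ is the Wells map.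
   Context: **Lie-Yamaguti algebras.** All vector spaces and algebras are over a field $k$. A Lie-Yamaguti algebra is a vector space $\mathfrak g$ with a bilinear map $[\cdot,\cdot]$ and a trilinear map $\{\cdot,\cdot,\cdot\}$ such that for all elements $[x_1,x_2]+[x_2,x_1]=0$, $\{x_1,x_2,x_3\}+\{x_2,x_1,x_3\}=0$; $[[x_1,x_2],x_3]+[[x_2,x_3],x_1]+[[x_3,x_1],x_2]+\{x_1,x_2,x_3\}+\{x_2,x_3,x_1\}+\{x_3,x_1,x_2\}=0$; $\{[x_1,x_2],x_3,y_1\}+\{[x_2,x_3],x_1,y_1\}+\{[x_3,x_1],x_2,y_1\}=0$; $\{x_1,x_2,[y_1,y_2]\}=[\{x_1,x_2,y_1\},y_2]+[y_1,\{x_1,x_2,y_2\}]$; $\{x_1,x_2,\{y_1,y_2,y_3\}\}=\{\{x_1,x_2,y_1\},y_2,y_3\}+\{y_1,\{x_1,x_2,y_2\},y_3\}+\{y_1,y_2,\{x_1,x_2,y_3\}\}$. Homomorphisms are linear maps preserving both operations; $\mathrm{Aut}$ denotes the group of automorphisms. **Extensions.** A non-abelian extension of $\mathfrak g$ by $\mathfrak h$ is a short exact sequence of Lie-Yamaguti algebras $0\to\mathfrak h\xrightarrow{i}\hat{\mathfrak g}\xrightarrow{p}\mathfrak g\to0$; $\mathfrak h$ is identified with $i(\mathfrak h)$. A section of $p$ is a linear map $s$ with $ps=I_{\mathfrak g}$. $\mathrm{Aut}_{\mathfrak h}(\hat{\mathfrak g})=\{\gamma\in\mathrm{Aut}(\hat{\mathfrak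 g})\mid\gamma(\mathfrak h)=\mathfrak h\}$. **Induced cocycle.** The non-abelian $(2,3)$-cocycle induced by $s$ is: $\chi(x,y)=[s(x),s(y)]_{\hat{\mathfrak g}}-s[x,y]_{\mathfrak g}$, $\omega(x,y,z)=\{s(x),s(y),s(z)\}_{\hat{\mathfrak g}}-s\{x,y,z\}_{\mathfrak g}$, $\mu(x)a=[s(x),a]_{\hat{\mathfrak g}}$, $\theta(x,y)a=\{a,s(x),s(y)\}_{\hat{\mathfrak g}}$, $D(x,y)a=\{s(x),s(y),a\}_{\hat{\mathfrak g}}$, $\rho(x)(a,b)=\{s(x),a,b\}_{\hat{\mathfrak g}}$, $T(x)(a,b)=\{a,b,s(x)\}_{\hat{\mathfrak g}}$. **Non-abelian $(2,3)$-cocycles.** A non-abelian $(2,3)$-cocycle on $\mathfrak g$ with values in $\mathfrak h$ is a septuple $(\chi,\omega,\mu,\theta,D,\rho,T)$ of (multi)linear maps $\chi:\mathfrak g\otimes\mathfrak g\to\mathfrak h$, $\omega:\mathfrak g^{\otimes3}\to\mathfrak h$, $\mu:\mathfrak g\to\mathfrak{gl}(\mathfrak h)$, $\theta,D:\mathfrak g\otimes\mathfrak g\to\mathfrak{gl}(\mathfrak h)$, $\rho,T:\mathfrak g\to\mathrm{Hom}(\mathfrak h\otimes\mathfrak h,\mathfrak h)$ such that for all $x,y,z,w,x_i,y_i\in\mathfrak g$ and $a,b,c,d\in\mathfrak h$ (brackets of $\mathfrak g$ and of $\mathfrak h$ are written without subscripts): (i) $\chi(x,y)+\chi(y,x)=0$;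 $\omega(x,y,z)+\omega(y,x,z)=0$; $D(x,y)a+D(y,x)a=0$; $T(x)(a,b)+T(x)(b,a)=0$. (ii) $\chi([x,y],z)-\mu(z)\chi(x,y)+\omega(x,y,z)+\chi([y,z],x)-\mu(x)\chi(y,z)+\omega(y,z,x)+\chi([z,x],y)-\mu(y)\chi(z,x)+\omega(z,x,y)=0$; $\mu([x,y])a+[\chi(x,y),a]+D(x,y)a-\mu(x)\mu(y)a-\theta(y,x)a+\mu(y)\mu(x)a+\theta(x,y)a=0$; $[\mu(x)a,b]+\rho(x)(a,b)-\mu(x)[a,b]+T(x)(a,b)-[\mu(x)b,a]-\rho(x)(b,a)=0$. (iii) $\omega([x,y],z,w)+\omega([y,z],x,w)+\omega([z,x],y,w)+\theta(z,w)\chi(x,y)+\theta(x,w)\chi(y,z)+\theta(y,w)\chi(z,x)=0$; $D([x,y],z)a-\rho(z)(\chi(x,y),a)+D([y,z],x)a-\rho(x)(\chi(y,z),a)+D([z,x],y)a-\rho(y)(\chi(z,x),a)=0$; $\theta([x,y],z)a-T(z)(\chi(x,y),a)-\theta(x,z)\mu(y)a+\theta(y,z)\mu(x)a=0$; $\rho([x,y])(a,b)+\{\chi(x,y),a,b\}-\rho(x)(\mu(y)a,b)+\rho(y)(\mu(x)a,b)=0$; $T(y)(\mu(x)a,b)+\theta(x,y)[a,b]-T(y)(\mu(x)b,a)=0$; $\{\mu(x)a,b,c\}-\rho(x)([a,b],c)-\{\mu(x)b,a,c\}=0$; $T(x)([a,b],c)+T(x)([b,c],a)+T(x)([c,a],b)=0$.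 (iv) $\omega(x,y,[z,w])+D(x,y)\chi(z,w)=\chi(\{x,y,z\},w)-\mu(w)\omega(x,y,z)+\mu(z)\omega(x,y,w)+\chi(z,\{x,y,w\})$; $D(x,y)\mu(z)a=\mu(\{x,y,z\})a+[\omega(x,y,z),a]+\mu(z)D(x,y)a$; $\theta(x,[y,z])a-\rho(x)(a,\chi(y,z))=\mu(y)\theta(x,z)a-\mu(z)\theta(x,y)a$; $D(x,y)[a,b]=[D(x,y)a,b]+[a,D(x,y)b]$; $\rho(x)(a,\mu(y)b)+[\theta(x,y)a,b]-\mu(y)\rho(x)(a,b)=0$; $T([x,y])(a,b)+\{a,b,\chi(x,y)\}-\mu(x)T(y)(a,b)+\mu(y)T(x)(a,b)=0$; $\{a,b,\mu(x)c\}=\mu(x)\{a,b,c\}-[c,T(x)(a,b)]$; $\rho(x)(a,[b,c])=[\rho(x)(a,b),c]+[b,\rho(x)(a,c)]$. (v) $D(x_1,x_2)\omega(y_1,y_2,y_3)+\omega(x_1,x_2,\{y_1,y_2,y_3\})=\omega(\{x_1,x_2,y_1\},y_2,y_3)+\theta(y_2,y_3)\omega(x_1,x_2,y_1)+\omega(y_1,\{x_1,x_2,y_2\},y_3)-\theta(y_1,y_3)\omega(x_1,x_2,y_2)+\omega(y_1,y_2,\{x_1,x_2,y_3\})+D(y_1,y_2)\omega(x_1,x_2,y_3)$; $D(x,y)\theta(z,w)a-\theta(z,w)D(x,y)a=\theta(\{x,y,z\},w)a+\theta(z,\{x,y,w\})a-T(w)(\omega(x,y,z),a)-\rho(z)(a,\omega(x,y,w))$;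 $\theta(x,\{y,z,w\})a-\rho(x)(a,\omega(y,z,w))=\theta(z,w)\theta(x,y)a-\theta(y,w)\theta(x,z)a+D(y,z)\theta(x,w)a$; $D(x,y)D(z,w)a-D(z,w)D(x,y)a=D(\{x,y,z\},w)a+D(z,\{x,y,w\})a-\rho(w)(\omega(x,y,z),a)+\rho(z)(\omega(x,y,w),a)$; $D(x,y)\rho(z)(a,b)-\rho(\{x,y,z\})(a,b)=\rho(z)(D(x,y)a,b)+\rho(z)(a,D(x,y)b)+\{\omega(x,y,z),a,b\}$; $D(y,z)\rho(x)(a,b)=\rho(x)(a,D(y,z)b)-\rho(z)(\theta(x,y)a,b)+\rho(y)(\theta(x,z)a,b)$; $\theta(y,z)\rho(x)(a,b)=\rho(x)(a,\theta(y,z)b)-T(z)(\theta(x,y)a,b)-\rho(y)(b,\theta(x,z)a)$; $D(x,y)T(z)(a,b)-T(\{x,y,z\})(a,b)=T(z)(D(x,y)a,b)+T(z)(a,D(x,y)b)+\{a,b,\omega(x,y,z)\}$; $T(\{x,y,z\})(a,b)-D(x,y)T(z)(a,b)+\{a,b,\omega(x,y,z)\}=\theta(y,z)T(x)(a,b)-\theta(x,z)T(y)(a,b)$; $D(x,y)\{a,b,c\}=\{D(x,y)a,b,c\}+\{a,D(x,y)b,c\}+\{a,b,D(x,y)c\}$; $\rho(x)(a,\rho(y)(b,c))=\rho(y)(\rho(x)(a,b),c)+\rho(y)(b,\rho(x)(a,c))-\{\theta(x,y)a,b,c\}$; $\{a,b,\theta(x,y)c\}=\theta(x,y)\{a,b,c\}-T(y)(T(x)(a,b),c)-\rho(x)(c,T(y)(a,b))$;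 $\rho(x)(a,T(y)(b,c))=T(y)(\rho(x)(a,b),c)+T(y)(b,\rho(x)(a,c))-\{b,c,\theta(x,y)a\}$; $\{a,b,D(x,y)c\}=D(x,y)\{a,b,c\}-\rho(y)(T(x)(a,b),c)+\rho(x)(T(y)(a,b),c)$; $\{a,b,\rho(x)(c,d)\}=\rho(x)(\{a,b,c\},d)-\{c,T(x)(a,b),d\}+\rho(x)(c,\{a,b,d\})$; $\rho(x)(a,\{b,c,d\})=\{\rho(x)(a,b),c,d\}+\{b,\rho(x)(a,c),d\}+\{b,c,\rho(x)(a,d)\}$; $\{a,b,T(x)(c,d)\}=T(x)(\{a,b,c\},d)+T(x)(c,\{a,b,d\})+\{c,d,T(x)(a,b)\}$. **Equivalence.** $(\chi_1,\omega_1,\mu_1,\theta_1,D_1,\rho_1,T_1)$ and $(\chi_2,\omega_2,\mu_2,\theta_2,D_2,\rho_2,T_2)$ are equivalent if there is a linear map $\varphi:\mathfrak g\to\mathfrak h$ such that for all $x,y,z\in\mathfrak g$, $a,b\in\mathfrak h$: $\chi_1(x,y)-\chi_2(x,y)=[\varphi(x),\varphi(y)]+\varphi[x,y]-\mu_2(x)\varphi(y)+\mu_2(y)\varphi(x)$; $\omega_1(x,y,z)-\omega_2(x,y,z)=\theta_2(x,z)\varphi(y)-D_2(x,y)\varphi(z)+\rho_2(x)(\varphi(y),\varphi(z))-\theta_2(y,z)\varphi(x)+T_2(z)(\varphi(x),\varphi(y))-\rho_2(y)(\varphi(x),\varphi(z))-\{\varphi(x),\varphi(y),\varphi(z)\}+\varphi\{x,y,z\}$;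 $\mu_1(x)a-\mu_2(x)a=[a,\varphi(x)]$; $\theta_1(x,y)a-\theta_2(x,y)a=\rho_2(x)(a,\varphi(y))-T_2(y)(a,\varphi(x))+\{a,\varphi(x),\varphi(y)\}$; $D_1(x,y)a-D_2(x,y)a=\rho_2(y)(\varphi(x),a)-\rho_2(x)(\varphi(y),a)+\{\varphi(x),\varphi(y),a\}$; $\rho_1(x)(a,b)-\rho_2(x)(a,b)=\{a,\varphi(x),b\}$; $T_1(x)(a,b)-T_2(x)(a,b)=\{b,a,\varphi(x)\}$. $H^{(2,3)}_{nab}(\mathfrak g,\mathfrak h)$ is the set of equivalence classes $[(\chi,\omega,\mu,\theta,D,\rho,T)]$ of non-abelian $(2,3)$-cocycles. **Wells map.** With $(\chi,\omega,\mu,\theta,D,\rho,T)$ induced by $s$ and $(\alpha,\beta)\in\mathrm{Aut}(\mathfrak g)\times\mathrm{Aut}(\mathfrak h)$, put $\chi_{(\alpha,\beta)}(x,y)=\beta\chi(\alpha^{-1}x,\alpha^{-1}y)$, $\omega_{(\alpha,\beta)}(x,y,z)=\beta\omega(\alpha^{-1}x,\alpha^{-1}y,\alpha^{-1}z)$, $\mu_{(\alpha,\beta)}(x)a=\beta\mu(\alpha^{-1}x)\beta^{-1}a$, $\theta_{(\alpha,\beta)}(x,y)a=\beta\theta(\alpha^{-1}x,\alpha^{-1}y)\beta^{-1}a$, $D_{(\alpha,\beta)}(x,y)a=\beta D(\alpha^{-1}x,\alpha^{-1}y)\beta^{-1}a$, $\rho_{(\alpha,\beta)}(x)(a,b)=\beta\rho(\alpha^{-1}x)(\beta^{-1}a,\beta^{-1}b)$,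 $T_{(\alpha,\beta)}(x)(a,b)=\beta T(\alpha^{-1}x)(\beta^{-1}a,\beta^{-1}b)$; this twisted septuple is again a non-abelian $(2,3)$-cocycle. The Wells map $W:\mathrm{Aut}(\mathfrak g)\times\mathrm{Aut}(\mathfrak h)\to H^{(2,3)}_{nab}(\mathfrak g,\mathfrak h)$ is defined by the class of the difference $$W(\alpha,\beta)=[(\chi_{(\alpha,\beta)},\omega_{(\alpha,\beta)},\mu_{(\alpha,\beta)},\theta_{(\alpha,\beta)},D_{(\alpha,\beta)},\rho_{(\alpha,\beta)},T_{(\alpha,\beta)})-(\chi,\omega,\mu,\theta,D,\rho,T)].$$ Membership $(\alpha,\beta)\in\mathrm{Ker}\,W$ is understood as: the twisted septuple and the original one are equivalent. The map $K:\mathrm{Aut}_{\mathfrak h}(\hat{\mathfrak g})\to\mathrm{Aut}(\mathfrak g)\times\mathrm{Aut}(\mathfrak h)$ is a group homomorphism. Exactness means: $H$ injective, $\mathrm{Im}\,H=\mathrm{Ker}\,K$, $\mathrm{Im}\,K=\mathrm{Ker}\,W$.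
   Formalization: The difference of the twisted and the original cocycle need not be a cocycle, so its class may not exist; W(α,β) is taken instead as the class of the twisted cocycle, with the class of the original cocycle as base point, and Ker W is the set of pairs whose twisted cocycle is equivalent to the original. *)

theory Defs
  imports Complex_Main "HOL-Algebra.Coset"
begin

definition bilinear_map ::
  "('k::field \<Rightarrow> 'a::ab_group_add \<Rightarrow> 'a) \<Rightarrow> ('k \<Rightarrow> 'b::ab_group_add \<Rightarrow> 'b) \<Rightarrow>
   ('k \<Rightarrow> 'c::ab_group_add \<Rightarrow> 'c) \<Rightarrow> ('a \<Rightarrow> 'b \<Rightarrow> 'c) \<Rightarrow> bool" where
  "bilinear_map s1 s2 s3 f \<longleftrightarrow>
     (\<forall>x. Vector_Spaces.linear s2 s3 (\<lambda>y. f x y)) \<and>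
     (\<forall>y. Vector_Spaces.linear s1 s3 (\<lambda>x. f x y))"

definition trilinear_map ::
  "('k::field \<Rightarrow> 'a::ab_group_add \<Rightarrow> 'a) \<Rightarrow> ('k \<Rightarrow> 'b::ab_group_add \<Rightarrow> 'b) \<Rightarrow>
   ('k \<Rightarrow> 'c::ab_group_add \<Rightarrow> 'c) \<Rightarrow> ('k \<Rightarrow> 'd::ab_group_add \<Rightarrow> 'd) \<Rightarrow>
   ('a \<Rightarrow> 'b \<Rightarrow> 'c \<Rightarrow> 'd) \<Rightarrow> bool" where
  "trilinear_map s1 s2 s3 s4 f \<longleftrightarrow>
     (\<forall>x y. Vector_Spaces.linear s3 s4 (\<lambda>z. f x y z)) \<and>
     (\<forall>x z. Vector_Spaces.linear s2 s4 (\<lambda>y. f x y z)) \<and>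
     (\<forall>y z. Vector_Spaces.linear s1 s4 (\<lambda>x. f x y z))"

text \<open>The underlying vector space of an algebra is a whole type, with its own scalar multiplication.\<close>

record ('k, 'v) ly_struct =
  scl :: "'k \<Rightarrow> 'v \<Rightarrow> 'v"
  brk :: "'v \<Rightarrow> 'v \<Rightarrow> 'v" ("\<lbrakk>_, _\<rbrakk>\<index>")
  trp :: "'v \<Rightarrow> 'v \<Rightarrow> 'v \<Rightarrow> 'v" ("\<lbrace>_, _, _\<rbrace>\<index>")

locale lie_yamaguti =
  vector_space "scl L" for L :: "('k::field, 'v::ab_group_add) ly_struct" (structure) +
  assumes brk_bilinear: "bilinear_map (scl L) (scl L) (scl L) (brk L)"
    and trp_trilinear: "trilinear_map (scl L) (scl L) (scl L) (scl L) (trp L)"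
    and brk_skew: "\<lbrakk>x1, x2\<rbrakk> + \<lbrakk>x2, x1\<rbrakk> = 0"
    and trp_skew: "\<lbrace>x1, x2, x3\<rbrace> + \<lbrace>x2, x1, x3\<rbrace> = 0"
    and brk_jacobi:
      "\<lbrakk>\<lbrakk>x1, x2\<rbrakk>, x3\<rbrakk> + \<lbrakk>\<lbrakk>x2, x3\<rbrakk>, x1\<rbrakk> + \<lbrakk>\<lbrakk>x3, x1\<rbrakk>, x2\<rbrakk>
         + \<lbrace>x1, x2, x3\<rbrace> + \<lbrace>x2, x3, x1\<rbrace> + \<lbrace>x3, x1, x2\<rbrace> = 0"
    and trp_cyclic:
      "\<lbrace>\<lbrakk>x1, x2\<rbrakk>, x3, y1\<rbrace> + \<lbrace>\<lbrakk>x2, x3\<rbrakk>, x1, y1\<rbrace> + \<lbrace>\<lbrakk>x3, x1\<rbrakk>, x2, y1\<rbrace> = 0"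
    and trp_brk:
      "\<lbrace>x1, x2, \<lbrakk>y1, y2\<rbrakk>\<rbrace> = \<lbrakk>\<lbrace>x1, x2, y1\<rbrace>, y2\<rbrakk> + \<lbrakk>y1, \<lbrace>x1, x2, y2\<rbrace>\<rbrakk>"
    and trp_trp:
      "\<lbrace>x1, x2, \<lbrace>y1, y2, y3\<rbrace>\<rbrace> =
         \<lbrace>\<lbrace>x1, x2, y1\<rbrace>, y2, y3\<rbrace> + \<lbrace>y1, \<lbrace>x1, x2, y2\<rbrace>, y3\<rbrace> + \<lbrace>y1, y2, \<lbrace>x1, x2, y3\<rbrace>\<rbrace>"

definition ly_hom ::
  "('k::field, 'v::ab_group_add) ly_struct \<Rightarrow> ('k, 'w::ab_group_add) ly_struct \<Rightarrow> ('v \<Rightarrow> 'w) set" where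
  "ly_hom L M = {f. Vector_Spaces.linear (scl L) (scl M) f \<and>
     (\<forall>x y. f \<lbrakk>x, y\<rbrakk>\<^bsub>L\<^esub> = \<lbrakk>f x, f y\<rbrakk>\<^bsub>M\<^esub>) \<and>
     (\<forall>x y z. f \<lbrace>x, y, z\<rbrace>\<^bsub>L\<^esub> = \<lbrace>f x, f y, f z\<rbrace>\<^bsub>M\<^esub>)}"

definition ly_Aut :: "('k::field, 'v::ab_group_add) ly_struct \<Rightarrow> ('v \<Rightarrow> 'v) monoid" where
  "ly_Aut L = \<lparr>carrier = {f \<in> ly_hom L L. bij f}, mult = (\<circ>), one = id\<rparr>"

locale ly_extension =
  H: lie_yamaguti H + E: lie_yamaguti E + G: lie_yamaguti G
  for H :: "('k::field, 'h::ab_group_add) ly_struct"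
    and E :: "('k, 'e::ab_group_add) ly_struct"
    and G :: "('k, 'g::ab_group_add) ly_struct" +
  fixes i :: "'h \<Rightarrow> 'e" and p :: "'e \<Rightarrow> 'g"
  assumes i_hom: "i \<in> ly_hom H E"
    and p_hom: "p \<in> ly_hom E G"
    and i_inj: "inj i"
    and p_surj: "surj p"
    and exact: "range i = p -` {0}"

definition ly_section ::
  "('k::field, 'e::ab_group_add) ly_struct \<Rightarrow> ('k, 'g::ab_group_add) ly_struct \<Rightarrow>
   ('e \<Rightarrow> 'g) \<Rightarrow> ('g \<Rightarrow> 'e) \<Rightarrow> bool" where
  "ly_section E G p s \<longleftrightarrow> Vector_Spaces.linear (scl G) (scl E) s \<and> p \<circ> s = id"

locale nonabelian_cocycle =
  G: lie_yamaguti G + H: lie_yamaguti H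
  for G :: "('k::field, 'g::ab_group_add) ly_struct"
    and H :: "('k, 'h::ab_group_add) ly_struct" +
  fixes \<chi> :: "'g \<Rightarrow> 'g \<Rightarrow> 'h"
    and \<omega> :: "'g \<Rightarrow> 'g \<Rightarrow> 'g \<Rightarrow> 'h"
    and \<mu> :: "'g \<Rightarrow> 'h \<Rightarrow> 'h"
    and \<theta> D :: "'g \<Rightarrow> 'g \<Rightarrow> 'h \<Rightarrow> 'h"
    and \<rho> T :: "'g \<Rightarrow> 'h \<Rightarrow> 'h \<Rightarrow> 'h"
  assumes cocycle_linear:
      "bilinear_map (scl G) (scl G) (scl H) \<chi>"
      "trilinear_map (scl G) (scl G) (scl G) (scl H) \<omega>"
      "bilinear_map (scl G) (scl H) (scl H) \<mu>"
      "trilinear_map (scl G) (scl G) (scl H) (scl H) \<theta>"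
      "trilinear_map (scl G) (scl G) (scl H) (scl H) D"
      "trilinear_map (scl G) (scl H) (scl H) (scl H) \<rho>"
      "trilinear_map (scl G) (scl H) (scl H) (scl H) T"
    and cocycle_i:
      "\<And>x y. \<chi> x y + \<chi> y x = 0"
      "\<And>x y z. \<omega> x y z + \<omega> y x z = 0"
      "\<And>x y a. D x y a + D y x a = 0"
      "\<And>x a b. T x a b + T x b a = 0"
    and cocycle_ii:
      "\<And>x y z. \<chi> \<lbrakk>x, y\<rbrakk>\<^bsub>G\<^esub> z - \<mu> z (\<chi> x y) + \<omega> x y z + \<chi> \<lbrakk>y, z\<rbrakk>\<^bsub>G\<^esub> x
        - \<mu> x (\<chi> y z) + \<omega> y z x + \<chi> \<lbrakk>z, x\<rbrakk>\<^bsub>G\<^esub> y - \<mu> y (\<chi> z x) + \<omega> z x y = 0"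
      "\<And>x y a. \<mu> \<lbrakk>x, y\<rbrakk>\<^bsub>G\<^esub> a + \<lbrakk>\<chi> x y, a\<rbrakk>\<^bsub>H\<^esub> + D x y a - \<mu> x (\<mu> y a) - \<theta> y x a + \<mu> y (\<mu> x a) + \<theta> x y a = 0"
      "\<And>x a b. \<lbrakk>\<mu> x a, b\<rbrakk>\<^bsub>H\<^esub> + \<rho> x a b - \<mu> x \<lbrakk>a, b\<rbrakk>\<^bsub>H\<^esub> + T x a b - \<lbrakk>\<mu> x b, a\<rbrakk>\<^bsub>H\<^esub> - \<rho> x b a = 0"
    and cocycle_iii:
      "\<And>x y z w. \<omega> \<lbrakk>x, y\<rbrakk>\<^bsub>G\<^esub> z w + \<omega> \<lbrakk>y, z\<rbrakk>\<^bsub>G\<^esub> x w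
        + \<omega> \<lbrakk>z, x\<rbrakk>\<^bsub>G\<^esub> y w + \<theta> z w (\<chi> x y) + \<theta> x w (\<chi> y z) + \<theta> y w (\<chi> z x) = 0"
      "\<And>x y z a. D \<lbrakk>x, y\<rbrakk>\<^bsub>G\<^esub> z a - \<rho> z (\<chi> x y) a + D \<lbrakk>y, z\<rbrakk>\<^bsub>G\<^esub> x a - \<rho> x (\<chi> y z) a
        + D \<lbrakk>z, x\<rbrakk>\<^bsub>G\<^esub> y a - \<rho> y (\<chi> z x) a = 0"
      "\<And>x y z a. \<theta> \<lbrakk>x, y\<rbrakk>\<^bsub>G\<^esub> z a - T z (\<chi> x y) a - \<theta> x z (\<mu> y a) + \<theta> y z (\<mu> x a) = 0"
      "\<And>x y a b. \<rho> \<lbrakk>x, y\<rbrakk>\<^bsub>G\<^esub> a b + \<lbrace>\<chi> x y, a, b\<rbrace>\<^bsub>H\<^esub> - \<rho> x (\<mu> y a) b + \<rho> y (\<mu> x a) b = 0"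
      "\<And>x y a b. T y (\<mu> x a) b + \<theta> x y \<lbrakk>a, b\<rbrakk>\<^bsub>H\<^esub> - T y (\<mu> x b) a = 0"
      "\<And>x a b c. \<lbrace>\<mu> x a, b, c\<rbrace>\<^bsub>H\<^esub> - \<rho> x \<lbrakk>a, b\<rbrakk>\<^bsub>H\<^esub> c - \<lbrace>\<mu> x b, a, c\<rbrace>\<^bsub>H\<^esub> = 0"
      "\<And>x a b c. T x \<lbrakk>a, b\<rbrakk>\<^bsub>H\<^esub> c + T x \<lbrakk>b, c\<rbrakk>\<^bsub>H\<^esub> a + T x \<lbrakk>c, a\<rbrakk>\<^bsub>H\<^esub> b = 0"
    and cocycle_iv:
      "\<And>x y z w. \<omega> x y \<lbrakk>z, w\<rbrakk>\<^bsub>G\<^esub> + D x y (\<chi> z w) = \<chi> \<lbrace>x, y, z\<rbrace>\<^bsub>G\<^esub> w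
        - \<mu> w (\<omega> x y z) + \<mu> z (\<omega> x y w) + \<chi> z \<lbrace>x, y, w\<rbrace>\<^bsub>G\<^esub>"
      "\<And>x y z a. D x y (\<mu> z a) = \<mu> \<lbrace>x, y, z\<rbrace>\<^bsub>G\<^esub> a + \<lbrakk>\<omega> x y z, a\<rbrakk>\<^bsub>H\<^esub> + \<mu> z (D x y a)"
      "\<And>x y z a. \<theta> x \<lbrakk>y, z\<rbrakk>\<^bsub>G\<^esub> a - \<rho> x a (\<chi> y z) = \<mu> y (\<theta> x z a) - \<mu> z (\<theta> x y a)"
      "\<And>x y a b. D x y \<lbrakk>a, b\<rbrakk>\<^bsub>H\<^esub> = \<lbrakk>D x y a, b\<rbrakk>\<^bsub>H\<^esub> + \<lbrakk>a, D x y b\<rbrakk>\<^bsub>H\<^esub>"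
      "\<And>x y a b. \<rho> x a (\<mu> y b) + \<lbrakk>\<theta> x y a, b\<rbrakk>\<^bsub>H\<^esub> - \<mu> y (\<rho> x a b) = 0"
      "\<And>x y a b. T \<lbrakk>x, y\<rbrakk>\<^bsub>G\<^esub> a b + \<lbrace>a, b, \<chi> x y\<rbrace>\<^bsub>H\<^esub> - \<mu> x (T y a b) + \<mu> y (T x a b) = 0"
      "\<And>x a b c. \<lbrace>a, b, \<mu> x c\<rbrace>\<^bsub>H\<^esub> = \<mu> x \<lbrace>a, b, c\<rbrace>\<^bsub>H\<^esub> - \<lbrakk>c, T x a b\<rbrakk>\<^bsub>H\<^esub>"
      "\<And>x a b c. \<rho> x a \<lbrakk>b, c\<rbrakk>\<^bsub>H\<^esub> = \<lbrakk>\<rho> x a b, c\<rbrakk>\<^bsub>H\<^esub> + \<lbrakk>b, \<rho> x a c\<rbrakk>\<^bsub>H\<^esub>"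
    and cocycle_v:
      "\<And>x1 x2 y1 y2 y3. D x1 x2 (\<omega> y1 y2 y3) + \<omega> x1 x2 \<lbrace>y1, y2, y3\<rbrace>\<^bsub>G\<^esub>
        = \<omega> \<lbrace>x1, x2, y1\<rbrace>\<^bsub>G\<^esub> y2 y3 + \<theta> y2 y3 (\<omega> x1 x2 y1)
        + \<omega> y1 \<lbrace>x1, x2, y2\<rbrace>\<^bsub>G\<^esub> y3 - \<theta> y1 y3 (\<omega> x1 x2 y2)
        + \<omega> y1 y2 \<lbrace>x1, x2, y3\<rbrace>\<^bsub>G\<^esub> + D y1 y2 (\<omega> x1 x2 y3)"
      "\<And>x y z w a. D x y (\<theta> z w a) - \<theta> z w (D x y a) = \<theta> \<lbrace>x, y, z\<rbrace>\<^bsub>G\<^esub> w a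
        + \<theta> z \<lbrace>x, y, w\<rbrace>\<^bsub>G\<^esub> a - T w (\<omega> x y z) a - \<rho> z a (\<omega> x y w)"
      "\<And>x y z w a. \<theta> x \<lbrace>y, z, w\<rbrace>\<^bsub>G\<^esub> a - \<rho> x a (\<omega> y z w) = \<theta> z w (\<theta> x y a) - \<theta> y w (\<theta> x z a) + D y z (\<theta> x w a)"
      "\<And>x y z w a. D x y (D z w a) - D z w (D x y a) = D \<lbrace>x, y, z\<rbrace>\<^bsub>G\<^esub> w a + D z \<lbrace>x, y, w\<rbrace>\<^bsub>G\<^esub> a - \<rho> w (\<omega> x y z) a + \<rho> z (\<omega> x y w) a"
      "\<And>x y z a b. D x y (\<rho> z a b) - \<rho> \<lbrace>x, y, z\<rbrace>\<^bsub>G\<^esub> a b = \<rho> z (D x y a) b + \<rho> z a (D x y b) + \<lbrace>\<omega> x y z, a, b\<rbrace>\<^bsub>H\<^esub>"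
      "\<And>x y z a b. D y z (\<rho> x a b) = \<rho> x a (D y z b) - \<rho> z (\<theta> x y a) b + \<rho> y (\<theta> x z a) b"
      "\<And>x y z a b. \<theta> y z (\<rho> x a b) = \<rho> x a (\<theta> y z b) - T z (\<theta> x y a) b - \<rho> y b (\<theta> x z a)"
      "\<And>x y z a b. D x y (T z a b) - T \<lbrace>x, y, z\<rbrace>\<^bsub>G\<^esub> a b = T z (D x y a) b + T z a (D x y b) + \<lbrace>a, b, \<omega> x y z\<rbrace>\<^bsub>H\<^esub>"
      "\<And>x y z a b. T \<lbrace>x, y, z\<rbrace>\<^bsub>G\<^esub> a b - D x y (T z a b) + \<lbrace>a, b, \<omega> x y z\<rbrace>\<^bsub>H\<^esub> = \<theta> y z (T x a b) - \<theta> x z (T y a b)"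
      "\<And>x y a b c. D x y \<lbrace>a, b, c\<rbrace>\<^bsub>H\<^esub> = \<lbrace>D x y a, b, c\<rbrace>\<^bsub>H\<^esub> + \<lbrace>a, D x y b, c\<rbrace>\<^bsub>H\<^esub>
        + \<lbrace>a, b, D x y c\<rbrace>\<^bsub>H\<^esub>"
      "\<And>x y a b c. \<rho> x a (\<rho> y b c) = \<rho> y (\<rho> x a b) c + \<rho> y b (\<rho> x a c) - \<lbrace>\<theta> x y a, b, c\<rbrace>\<^bsub>H\<^esub>"
      "\<And>x y a b c. \<lbrace>a, b, \<theta> x y c\<rbrace>\<^bsub>H\<^esub> = \<theta> x y \<lbrace>a, b, c\<rbrace>\<^bsub>H\<^esub> - T y (T x a b) c - \<rho> x c (T y a b)"
      "\<And>x y a b c. \<rho> x a (T y b c) = T y (\<rho> x a b) c + T y b (\<rho> x a c) - \<lbrace>b, c, \<theta> x y a\<rbrace>\<^bsub>H\<^esub>"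
      "\<And>x y a b c. \<lbrace>a, b, D x y c\<rbrace>\<^bsub>H\<^esub> = D x y \<lbrace>a, b, c\<rbrace>\<^bsub>H\<^esub> - \<rho> y (T x a b) c + \<rho> x (T y a b) c"
      "\<And>x a b c d. \<lbrace>a, b, \<rho> x c d\<rbrace>\<^bsub>H\<^esub> = \<rho> x \<lbrace>a, b, c\<rbrace>\<^bsub>H\<^esub> d
        - \<lbrace>c, T x a b, d\<rbrace>\<^bsub>H\<^esub> + \<rho> x c \<lbrace>a, b, d\<rbrace>\<^bsub>H\<^esub>"
      "\<And>x a b c d. \<rho> x a \<lbrace>b, c, d\<rbrace>\<^bsub>H\<^esub> = \<lbrace>\<rho> x a b, c, d\<rbrace>\<^bsub>H\<^esub>
        + \<lbrace>b, \<rho> x a c, d\<rbrace>\<^bsub>H\<^esub> + \<lbrace>b, c, \<rho> x a d\<rbrace>\<^bsub>H\<^esub>"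
      "\<And>x a b c d. \<lbrace>a, b, T x c d\<rbrace>\<^bsub>H\<^esub> = T x \<lbrace>a, b, c\<rbrace>\<^bsub>H\<^esub> d + T x c \<lbrace>a, b, d\<rbrace>\<^bsub>H\<^esub>
        + \<lbrace>c, d, T x a b\<rbrace>\<^bsub>H\<^esub>"

text \<open>The components of a septuple are, in order, \<open>(\<chi>, \<omega>, \<mu>, \<theta>, D, \<rho>, T)\<close>.\<close>

type_synonym ('g, 'h) septuple =
  "('g \<Rightarrow> 'g \<Rightarrow> 'h) \<times> ('g \<Rightarrow> 'g \<Rightarrow> 'g \<Rightarrow> 'h) \<times> ('g \<Rightarrow> 'h \<Rightarrow> 'h) \<times>
   ('g \<Rightarrow> 'g \<Rightarrow> 'h \<Rightarrow> 'h) \<times> ('g \<Rightarrow> 'g \<Rightarrow> 'h \<Rightarrow> 'h) \<times>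
   ('g \<Rightarrow> 'h \<Rightarrow> 'h \<Rightarrow> 'h) \<times> ('g \<Rightarrow> 'h \<Rightarrow> 'h \<Rightarrow> 'h)"

definition nab_cocycles ::
  "('k::field, 'g::ab_group_add) ly_struct \<Rightarrow> ('k, 'h::ab_group_add) ly_struct \<Rightarrow>
   ('g, 'h) septuple set" where
  "nab_cocycles G H = {(\<chi>, \<omega>, \<mu>, \<theta>, D, \<rho>, T). nonabelian_cocycle G H \<chi> \<omega> \<mu> \<theta> D \<rho> T}"

definition nab_equivalent ::
  "('k::field, 'g::ab_group_add) ly_struct \<Rightarrow> ('k, 'h::ab_group_add) ly_struct \<Rightarrow>
   ('g, 'h) septuple \<Rightarrow> ('g, 'h) septuple \<Rightarrow> bool" where
  "nab_equivalent G H = (\<lambda>(\<chi>\<^sub>1, \<omega>\<^sub>1, \<mu>\<^sub>1, \<theta>\<^sub>1, D\<^sub>1, \<rho>\<^sub>1, T\<^sub>1) (\<chi>\<^sub>2, \<omega>\<^sub>2, \<mu>\<^sub>2, \<theta>\<^sub>2, D\<^sub>2, \<rho>\<^sub>2, T\<^sub>2).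
     \<exists>\<phi>. Vector_Spaces.linear (scl G) (scl H) \<phi> \<and>
        (\<forall>x y. \<chi>\<^sub>1 x y - \<chi>\<^sub>2 x y = \<lbrakk>\<phi> x, \<phi> y\<rbrakk>\<^bsub>H\<^esub> + \<phi> \<lbrakk>x, y\<rbrakk>\<^bsub>G\<^esub>
          - \<mu>\<^sub>2 x (\<phi> y) + \<mu>\<^sub>2 y (\<phi> x)) \<and>
        (\<forall>x y z. \<omega>\<^sub>1 x y z - \<omega>\<^sub>2 x y z = \<theta>\<^sub>2 x z (\<phi> y) - D\<^sub>2 x y (\<phi> z) + \<rho>\<^sub>2 x (\<phi> y) (\<phi> z)
          - \<theta>\<^sub>2 y z (\<phi> x) + T\<^sub>2 z (\<phi> x) (\<phi> y) - \<rho>\<^sub>2 y (\<phi> x) (\<phi> z)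
          - \<lbrace>\<phi> x, \<phi> y, \<phi> z\<rbrace>\<^bsub>H\<^esub> + \<phi> \<lbrace>x, y, z\<rbrace>\<^bsub>G\<^esub>) \<and>
        (\<forall>x a. \<mu>\<^sub>1 x a - \<mu>\<^sub>2 x a = \<lbrakk>a, \<phi> x\<rbrakk>\<^bsub>H\<^esub>) \<and>
        (\<forall>x y a. \<theta>\<^sub>1 x y a - \<theta>\<^sub>2 x y a = \<rho>\<^sub>2 x a (\<phi> y) - T\<^sub>2 y a (\<phi> x) + \<lbrace>a, \<phi> x, \<phi> y\<rbrace>\<^bsub>H\<^esub>) \<and>
        (\<forall>x y a. D\<^sub>1 x y a - D\<^sub>2 x y a = \<rho>\<^sub>2 y (\<phi> x) a - \<rho>\<^sub>2 x (\<phi> y) a + \<lbrace>\<phi> x, \<phi> y, a\<rbrace>\<^bsub>H\<^esub>) \<and>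
        (\<forall>x a b. \<rho>\<^sub>1 x a b - \<rho>\<^sub>2 x a b = \<lbrace>a, \<phi> x, b\<rbrace>\<^bsub>H\<^esub>) \<and>
        (\<forall>x a b. T\<^sub>1 x a b - T\<^sub>2 x a b = \<lbrace>b, a, \<phi> x\<rbrace>\<^bsub>H\<^esub>))"

definition nab_equiv_rel ::
  "('k::field, 'g::ab_group_add) ly_struct \<Rightarrow> ('k, 'h::ab_group_add) ly_struct \<Rightarrow>
   (('g, 'h) septuple \<times> ('g, 'h) septuple) set" where
  "nab_equiv_rel G H =
     {(c1, c2). c1 \<in> nab_cocycles G H \<and> c2 \<in> nab_cocycles G H \<and> nab_equivalent G H c1 c2}"

definition H23_nab ::
  "('k::field, 'g::ab_group_add) ly_struct \<Rightarrow> ('k, 'h::ab_group_add) ly_struct \<Rightarrow>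
   ('g, 'h) septuple set set" where
  "H23_nab G H = nab_cocycles G H // nab_equiv_rel G H"

text \<open>
  The ideal \<open>i(\<hh>)\<close> is not identified with \<open>\<hh>\<close>: all values below that lie in the
  kernel of \<open>p\<close>, i.e. in the range of \<open>i\<close>, are pulled back along the injection \<open>i\<close>.
  (\<open>inv_into UNIV f\<close> is written out, since HOL-Algebra takes over the notation \<open>inv\<close>.)
\<close>

definition induced_cocycle ::
  "('k::field, 'e::ab_group_add) ly_struct \<Rightarrow> ('k, 'g::ab_group_add) ly_struct \<Rightarrow>
   ('h \<Rightarrow> 'e) \<Rightarrow> ('g \<Rightarrow> 'e) \<Rightarrow> ('g, 'h) septuple" where
  "induced_cocycle E G i s = (let j = inv_into UNIV i in
    (\<lambda>x y. j (\<lbrakk>s x, s y\<rbrakk>\<^bsub>E\<^esub> - s \<lbrakk>x, y\<rbrakk>\<^bsub>G\<^esub>),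
     \<lambda>x y z. j (\<lbrace>s x, s y, s z\<rbrace>\<^bsub>E\<^esub> - s \<lbrace>x, y, z\<rbrace>\<^bsub>G\<^esub>),
     \<lambda>x a. j \<lbrakk>s x, i a\<rbrakk>\<^bsub>E\<^esub>,
     \<lambda>x y a. j \<lbrace>i a, s x, s y\<rbrace>\<^bsub>E\<^esub>,
     \<lambda>x y a. j \<lbrace>s x, s y, i a\<rbrace>\<^bsub>E\<^esub>,
     \<lambda>x a b. j \<lbrace>s x, i a, i b\<rbrace>\<^bsub>E\<^esub>,
     \<lambda>x a b. j \<lbrace>i a, i b, s x\<rbrace>\<^bsub>E\<^esub>))"

definition twist ::
  "('g \<Rightarrow> 'g) \<Rightarrow> ('h \<Rightarrow> 'h) \<Rightarrow> ('g, 'h) septuple \<Rightarrow> ('g, 'h) septuple" where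
  "twist \<alpha> \<beta> = (\<lambda>(\<chi>, \<omega>, \<mu>, \<theta>, D, \<rho>, T).
    let \<alpha>' = inv_into UNIV \<alpha>; \<beta>' = inv_into UNIV \<beta> in
    (\<lambda>x y. \<beta> (\<chi> (\<alpha>' x) (\<alpha>' y)),
     \<lambda>x y z. \<beta> (\<omega> (\<alpha>' x) (\<alpha>' y) (\<alpha>' z)),
     \<lambda>x a. \<beta> (\<mu> (\<alpha>' x) (\<beta>' a)),
     \<lambda>x y a. \<beta> (\<theta> (\<alpha>' x) (\<alpha>' y) (\<beta>' a)),
     \<lambda>x y a. \<beta> (D (\<alpha>' x) (\<alpha>' y) (\<beta>' a)),
     \<lambda>x a b. \<beta> (\<rho> (\<alpha>' x) (\<beta>' a) (\<beta>' b)),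
     \<lambda>x a b. \<beta> (T (\<alpha>' x) (\<beta>' a) (\<beta>' b))))"

definition Aut_h ::
  "('k::field, 'e::ab_group_add) ly_struct \<Rightarrow> ('h \<Rightarrow> 'e) \<Rightarrow> ('e \<Rightarrow> 'e) monoid" where
  "Aut_h E i = (ly_Aut E)\<lparr>carrier := {\<gamma> \<in> carrier (ly_Aut E). \<gamma> ` range i = range i}\<rparr>"

definition K_map ::
  "('h \<Rightarrow> 'e) \<Rightarrow> ('e \<Rightarrow> 'g) \<Rightarrow> ('g \<Rightarrow> 'e) \<Rightarrow> ('e \<Rightarrow> 'e) \<Rightarrow> ('g \<Rightarrow> 'g) \<times> ('h \<Rightarrow> 'h)" where
  "K_map i p s \<gamma> = (p \<circ> \<gamma> \<circ> s, inv_into UNIV i \<circ> \<gamma> \<circ> i)"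

definition Aut_h_g ::
  "('k::field, 'e::ab_group_add) ly_struct \<Rightarrow> ('h \<Rightarrow> 'e) \<Rightarrow> ('e \<Rightarrow> 'g) \<Rightarrow> ('g \<Rightarrow> 'e) \<Rightarrow>
   ('e \<Rightarrow> 'e) monoid" where
  "Aut_h_g E i p s =
     (Aut_h E i)\<lparr>carrier := {\<gamma> \<in> carrier (Aut_h E i). K_map i p s \<gamma> = (id, id)}\<rparr>"

definition nab_class ::
  "('k::field, 'g::ab_group_add) ly_struct \<Rightarrow> ('k, 'h::ab_group_add) ly_struct \<Rightarrow>
   ('g, 'h) septuple \<Rightarrow> ('g, 'h) septuple set" where
  "nab_class G H c = nab_equiv_rel G H `` {c}"

text \<open>
  \<open>H23_nab G H\<close> carries no subtraction, and the componentwise difference of two cocycles is in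
  general not a cocycle.  The Wells map, whose value is written as the class of the difference
  of the twisted and the original cocycle, is therefore rendered as the class of the twisted
  cocycle in the set \<open>H23_nab G H\<close> pointed by the class of the original one; its kernel consists
  of the pairs whose twisted cocycle is equivalent to the original cocycle.
\<close>

definition Wells_map ::
  "('k::field, 'h::ab_group_add) ly_struct \<Rightarrow> ('k, 'e::ab_group_add) ly_struct \<Rightarrow>
   ('k, 'g::ab_group_add) ly_struct \<Rightarrow> ('h \<Rightarrow> 'e) \<Rightarrow> ('g \<Rightarrow> 'e) \<Rightarrow>
   ('g \<Rightarrow> 'g) \<times> ('h \<Rightarrow> 'h) \<Rightarrow> ('g, 'h) septuple set" where
  "Wells_map H E G i s = (\<lambda>(\<alpha>, \<beta>). nab_class G H (twist \<alpha> \<beta> (induced_cocycle E G i s)))"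

definition Wells_kernel ::
  "('k::field, 'h::ab_group_add) ly_struct \<Rightarrow> ('k, 'e::ab_group_add) ly_struct \<Rightarrow>
   ('k, 'g::ab_group_add) ly_struct \<Rightarrow> ('h \<Rightarrow> 'e) \<Rightarrow> ('g \<Rightarrow> 'e) \<Rightarrow>
   (('g \<Rightarrow> 'g) \<times> ('h \<Rightarrow> 'h)) set" where
  "Wells_kernel H E G i s =
     {(\<alpha>, \<beta>) \<in> carrier (ly_Aut G \<times>\<times> ly_Aut H).
        nab_equivalent G H (twist \<alpha> \<beta> (induced_cocycle E G i s)) (induced_cocycle E G i s)}"

end

theory Submission
  imports Defs
begin

text \<open>
  A linear section \<open>s\<close> of \<open>p\<close> splits \<open>E\<close> as a vector space: every \<open>e\<close> is \<open>s (p e) + i (q e)\<close> for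
  a unique linear \<open>q\<close>.  In these coordinates the products of \<open>E\<close> are given by the products of \<open>G\<close>
  and \<open>H\<close> and by the induced septuple, whose components are the \<open>q\<close>-parts of products of vectors
  \<open>s x\<close> and \<open>i a\<close>.  Each cocycle identity is the \<open>q\<close>-part of one Lie-Yamaguti identity of \<open>E\<close>,
  evaluated at such vectors (\<open>is_cocycle\<close>).

  Three observations reduce exactness at \<open>Aut(G) \<times> Aut(H)\<close> to transport of structure.

  \<^item> Twisting by \<open>(\<alpha>, \<beta>)\<close> amounts to presenting the same algebra \<open>E\<close> differently: the twisted
    septuple is the one induced by the section \<open>s \<circ> \<alpha>\<^sup>-\<^sup>1\<close> of the extension with injection
    \<open>i \<circ> \<beta>\<^sup>-\<^sup>1\<close> and projection \<open>\<alpha> \<circ> p\<close> (\<open>twist_induced_cocycle\<close>).  In particular it is a cocycle.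

  \<^item> The conditions for equivalence determine the first septuple from the second one and \<open>\<phi>\<close>, as
    its shift by \<open>\<phi>\<close>.  Shifts of cocycles compose by adding the maps \<open>\<phi>\<close> (\<open>nab_shift_add\<close>), which
    makes equivalence an equivalence relation.  Shifting an induced cocycle by \<open>\<phi>\<close> changes the
    section from \<open>s\<close> to \<open>s - i \<circ> \<phi>\<close> (\<open>induced_cocycle_shifted_section\<close>).

  \<^item> Two extensions with sections induce the same septuple if and only if some isomorphism of the
    middle algebras carries one injection and one section to the other (\<open>induced_cocycle_iso\<close>,
    \<open>iso_of_induced_cocycle_eq\<close>).

  Hence the twisted septuple is equivalent to the original one if and only if, for some \<open>\<phi>\<close>, an
  automorphism \<open>\<gamma>\<close> of \<open>E\<close> satisfies \<open>\<gamma> \<circ> i = i \<circ> \<beta>\<close> and \<open>\<gamma> \<circ> s = (s - i \<circ> \<phi>) \<circ> \<alpha>\<close>, which says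
  that \<open>K\<close> maps \<open>\<gamma>\<close> to \<open>(\<alpha>, \<beta>)\<close>.
\<close>

section \<open>Linear and multilinear maps\<close>

lemma linear_iff_all:
  "Vector_Spaces.linear s1 s2 f \<longleftrightarrow> vector_space s1 \<and> vector_space s2 \<and>
     (\<forall>x y. f (x + y) = f x + f y) \<and> (\<forall>c x. f (s1 c x) = s2 c (f x))"
  by (auto simp: Vector_Spaces.linear_def module_hom_def module_hom_axioms_def vector_space_def module_def)

lemma linear_map_simps:
  assumes "Vector_Spaces.linear s1 s2 f"
  shows "f (x + y) = f x + f y" "f (x - y) = f x - f y" "f (- x) = - f x" "f 0 = 0"
    "f (s1 c x) = s2 c (f x)"
proof -
  interpret Vector_Spaces.linear s1 s2 f by fact
  show "f (x + y) = f x + f y" "f (x - y) = f x - f y" "f (- x) = - f x" "f 0 = 0"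
    "f (s1 c x) = s2 c (f x)"
    by (simp_all add: add diff neg zero scale)
qed

lemma bilinear_map_simps:
  assumes "bilinear_map s1 s2 s3 f"
  shows "f (x + x') y = f x y + f x' y" "f x (y + y') = f x y + f x y'"
    "f (x - x') y = f x y - f x' y" "f x (y - y') = f x y - f x y'"
    "f (- x) y = - f x y" "f x (- y) = - f x y"
    "f 0 y = 0" "f x 0 = 0"
    "f (s1 c x) y = s3 c (f x y)" "f x (s2 c y) = s3 c (f x y)"
proof -
  have L: "Vector_Spaces.linear s1 s3 (\<lambda>x. f x y)" and R: "Vector_Spaces.linear s2 s3 (f x)" for x y
    using assms by (auto simp: bilinear_map_def)
  show "f (x + x') y = f x y + f x' y" "f x (y + y') = f x y + f x y'"
    "f (x - x') y = f x y - f x' y" "f x (y - y') = f x y - f x y'"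
    "f (- x) y = - f x y" "f x (- y) = - f x y"
    "f 0 y = 0" "f x 0 = 0"
    "f (s1 c x) y = s3 c (f x y)" "f x (s2 c y) = s3 c (f x y)"
    by (simp_all add: linear_map_simps[OF L] linear_map_simps[OF R])
qed

lemma trilinear_map_simps:
  assumes "trilinear_map s1 s2 s3 s4 f"
  shows "f (x + x') y z = f x y z + f x' y z" "f x (y + y') z = f x y z + f x y' z"
    "f x y (z + z') = f x y z + f x y z'"
    "f (x - x') y z = f x y z - f x' y z" "f x (y - y') z = f x y z - f x y' z"
    "f x y (z - z') = f x y z - f x y z'"
    "f (- x) y z = - f x y z" "f x (- y) z = - f x y z" "f x y (- z) = - f x y z"
    "f 0 y z = 0" "f x 0 z = 0" "f x y 0 = 0"
    "f (s1 c x) y z = s4 c (f x y z)" "f x (s2 c y) z = s4 c (f x y z)"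
    "f x y (s3 c z) = s4 c (f x y z)"
proof -
  have L: "Vector_Spaces.linear s1 s4 (\<lambda>x. f x y z)"
    and M: "Vector_Spaces.linear s2 s4 (\<lambda>y. f x y z)"
    and R: "Vector_Spaces.linear s3 s4 (f x y)" for x y z
    using assms by (auto simp: trilinear_map_def)
  show "f (x + x') y z = f x y z + f x' y z" "f x (y + y') z = f x y z + f x y' z"
    "f x y (z + z') = f x y z + f x y z'"
    "f (x - x') y z = f x y z - f x' y z" "f x (y - y') z = f x y z - f x y' z"
    "f x y (z - z') = f x y z - f x y z'"
    "f (- x) y z = - f x y z" "f x (- y) z = - f x y z" "f x y (- z) = - f x y z"
    "f 0 y z = 0" "f x 0 z = 0" "f x y 0 = 0"
    "f (s1 c x) y z = s4 c (f x y z)" "f x (s2 c y) z = s4 c (f x y z)"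
    "f x y (s3 c z) = s4 c (f x y z)"
    by (simp_all add: linear_map_simps[OF L] linear_map_simps[OF M] linear_map_simps[OF R])
qed

section \<open>Homomorphisms and automorphism groups\<close>

context lie_yamaguti
begin

lemmas brk_simps = bilinear_map_simps[OF brk_bilinear]
lemmas trp_simps = trilinear_map_simps[OF trp_trilinear]

lemma brk_swap: "\<lbrakk>x, y\<rbrakk> = - \<lbrakk>y, x\<rbrakk>"
  using brk_skew[of x y] by (simp add: eq_neg_iff_add_eq_0)

lemma trp_swap: "\<lbrace>x, y, z\<rbrace> = - \<lbrace>y, x, z\<rbrace>"
  using trp_skew[of x y z] by (simp add: eq_neg_iff_add_eq_0)

end

lemma ly_homD:
  assumes "f \<in> ly_hom L M"
  shows "Vector_Spaces.linear (scl L) (scl M) f"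
    and "f \<lbrakk>x, y\<rbrakk>\<^bsub>L\<^esub> = \<lbrakk>f x, f y\<rbrakk>\<^bsub>M\<^esub>"
    and "f \<lbrace>x, y, z\<rbrace>\<^bsub>L\<^esub> = \<lbrace>f x, f y, f z\<rbrace>\<^bsub>M\<^esub>"
  using assms by (auto simp: ly_hom_def)

lemma ly_hom_comp: "f \<in> ly_hom L M \<Longrightarrow> g \<in> ly_hom M N \<Longrightarrow> g \<circ> f \<in> ly_hom L N"
  by (auto simp: ly_hom_def linear_iff_all)

lemma ly_hom_inv:
  assumes f: "f \<in> ly_hom L M" and "bij f"
  shows "inv_into UNIV f \<in> ly_hom M L"
proof -
  let ?g = "inv_into UNIV f"
  have inv: "f (?g y) = y" "?g (f x) = x" for x y
    using \<open>bij f\<close> by (auto simp: bij_def surj_f_inv_f)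
  have g: "?g y = x" if "f x = y" for x y using that inv by auto
  show ?thesis
    using f unfolding ly_hom_def linear_iff_all by (auto intro!: g simp: inv)
qed

lemma (in lie_yamaguti) ly_hom_id: "id \<in> ly_hom L L"
  using vector_space_axioms by (auto simp: ly_hom_def linear_iff_all)

lemma carrier_ly_Aut: "f \<in> carrier (ly_Aut L) \<longleftrightarrow> f \<in> ly_hom L L \<and> bij f"
  by (simp add: ly_Aut_def)

lemma mult_ly_Aut [simp]: "f \<otimes>\<^bsub>ly_Aut L\<^esub> g = f \<circ> g"
  by (simp add: ly_Aut_def)

lemma one_ly_Aut [simp]: "\<one>\<^bsub>ly_Aut L\<^esub> = id"
  by (simp add: ly_Aut_def)

lemma inv_into_in_ly_Aut:
  "f \<in> carrier (ly_Aut L) \<Longrightarrow> inv_into UNIV f \<in> carrier (ly_Aut L)"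
  by (auto simp: carrier_ly_Aut ly_hom_inv bij_imp_bij_inv)

lemma (in lie_yamaguti) group_ly_Aut: "group (ly_Aut L)"
proof (rule groupI)
  fix f assume f: "f \<in> carrier (ly_Aut L)"
  then have "inv_into UNIV f \<circ> f = id" by (auto simp: carrier_ly_Aut bij_def)
  with f show "\<exists>g\<in>carrier (ly_Aut L). g \<otimes>\<^bsub>ly_Aut L\<^esub> f = \<one>\<^bsub>ly_Aut L\<^esub>"
    using inv_into_in_ly_Aut by auto
qed (auto simp: carrier_ly_Aut ly_hom_id bij_comp comp_assoc intro: ly_hom_comp)

lemma (in lie_yamaguti) m_inv_ly_Aut:
  assumes "f \<in> carrier (ly_Aut L)"
  shows "m_inv (ly_Aut L) f = inv_into UNIV f"
proof -
  have "inv_into UNIV f \<circ> f = id" using assms by (auto simp: carrier_ly_Aut bij_def)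
  then show ?thesis
    using group.inv_equality[OF group_ly_Aut, of "inv_into UNIV f" f] assms inv_into_in_ly_Aut by auto
qed

section \<open>Shifting a cocycle by a linear map\<close>

text \<open>The defining equations of the equivalence of septuples, solved for the first septuple: the
  shift of the given septuple by \<open>\<phi>\<close>.\<close>

definition nab_shift ::
  "('k::field, 'g::ab_group_add) ly_struct \<Rightarrow> ('k, 'h::ab_group_add) ly_struct \<Rightarrow>
   ('g \<Rightarrow> 'h) \<Rightarrow> ('g, 'h) septuple \<Rightarrow> ('g, 'h) septuple" where
  "nab_shift G H \<phi> = (\<lambda>(\<chi>, \<omega>, \<mu>, \<theta>, D, \<rho>, T).
    (\<lambda>x y. \<chi> x y + (\<lbrakk>\<phi> x, \<phi> y\<rbrakk>\<^bsub>H\<^esub> + \<phi> \<lbrakk>x, y\<rbrakk>\<^bsub>G\<^esub> - \<mu> x (\<phi> y) + \<mu> y (\<phi> x)),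
     \<lambda>x y z. \<omega> x y z + (\<theta> x z (\<phi> y) - D x y (\<phi> z) + \<rho> x (\<phi> y) (\<phi> z)
          - \<theta> y z (\<phi> x) + T z (\<phi> x) (\<phi> y) - \<rho> y (\<phi> x) (\<phi> z)
          - \<lbrace>\<phi> x, \<phi> y, \<phi> z\<rbrace>\<^bsub>H\<^esub> + \<phi> \<lbrace>x, y, z\<rbrace>\<^bsub>G\<^esub>),
     \<lambda>x a. \<mu> x a + \<lbrakk>a, \<phi> x\<rbrakk>\<^bsub>H\<^esub>,
     \<lambda>x y a. \<theta> x y a + (\<rho> x a (\<phi> y) - T y a (\<phi> x) + \<lbrace>a, \<phi> x, \<phi> y\<rbrace>\<^bsub>H\<^esub>),
     \<lambda>x y a. D x y a + (\<rho> y (\<phi> x) a - \<rho> x (\<phi> y) a + \<lbrace>\<phi> x, \<phi> y, a\<rbrace>\<^bsub>H\<^esub>),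
     \<lambda>x a b. \<rho> x a b + \<lbrace>a, \<phi> x, b\<rbrace>\<^bsub>H\<^esub>,
     \<lambda>x a b. T x a b + \<lbrace>b, a, \<phi> x\<rbrace>\<^bsub>H\<^esub>))"

lemma nab_equivalent_iff_shift:
  "nab_equivalent G H c1 c2 \<longleftrightarrow>
     (\<exists>\<phi>. Vector_Spaces.linear (scl G) (scl H) \<phi> \<and> c1 = nab_shift G H \<phi> c2)"
proof (cases c1, cases c2)
  fix \<chi>1 \<omega>1 \<mu>1 \<theta>1 D1 \<rho>1 T1 \<chi>2 \<omega>2 \<mu>2 \<theta>2 D2 \<rho>2 T2
  assume c: "c1 = (\<chi>1, \<omega>1, \<mu>1, \<theta>1, D1, \<rho>1, T1)" "c2 = (\<chi>2, \<omega>2, \<mu>2, \<theta>2, D2, \<rho>2, T2)"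
  have move: "a - b = d \<longleftrightarrow> a = b + d" for a b d :: 'c by (auto simp: algebra_simps)
  show ?thesis
    unfolding c nab_equivalent_def nab_shift_def split_conv prod.inject fun_eq_iff move ..
qed

lemma nab_shift_zero:
  assumes "lie_yamaguti H" "c \<in> nab_cocycles G H"
  shows "nab_shift G H (\<lambda>_. 0) c = c"
proof -
  interpret H: lie_yamaguti H by fact
  obtain \<chi> \<omega> \<mu> \<theta> D \<rho> T where c: "c = (\<chi>, \<omega>, \<mu>, \<theta>, D, \<rho>, T)" by (cases c)
  interpret nonabelian_cocycle G H \<chi> \<omega> \<mu> \<theta> D \<rho> T
    using assms c by (auto simp: nab_cocycles_def)
  show ?thesis
    unfolding c nab_shift_def split_conv
    by (simp add: H.brk_simps H.trp_simps bilinear_map_simps[OF cocycle_linear(3)]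
      trilinear_map_simps[OF cocycle_linear(4)] trilinear_map_simps[OF cocycle_linear(5)]
      trilinear_map_simps[OF cocycle_linear(6)] trilinear_map_simps[OF cocycle_linear(7)])
qed

text \<open>The terms that are quadratic or cubic in \<open>\<phi>\<close> and \<open>\<psi>\<close> match because the
  products of \<open>H\<close> and the component \<open>T\<close> are skew-symmetric.\<close>

lemma nab_shift_add:
  assumes "c \<in> nab_cocycles G H"
  shows "nab_shift G H \<phi> (nab_shift G H \<psi> c) = nab_shift G H (\<lambda>x. \<phi> x + \<psi> x) c"
proof -
  obtain \<chi> \<omega> \<mu> \<theta> D \<rho> T where c: "c = (\<chi>, \<omega>, \<mu>, \<theta>, D, \<rho>, T)" by (cases c)
  interpret nonabelian_cocycle G H \<chi> \<omega> \<mu> \<theta> D \<rho> T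
    using assms c by (auto simp: nab_cocycles_def)
  note lin = H.brk_simps H.trp_simps bilinear_map_simps[OF cocycle_linear(3)]
      trilinear_map_simps[OF cocycle_linear(4)] trilinear_map_simps[OF cocycle_linear(5)]
      trilinear_map_simps[OF cocycle_linear(6)] trilinear_map_simps[OF cocycle_linear(7)]
  have T_swap: "T x a b = - T x b a" for x a b
    using cocycle_i(4)[of x a b] by (simp add: eq_neg_iff_add_eq_0)
  have chi: "\<lbrakk>\<phi> y, \<psi> x\<rbrakk>\<^bsub>H\<^esub> = - \<lbrakk>\<psi> x, \<phi> y\<rbrakk>\<^bsub>H\<^esub>" for x y by (rule H.brk_swap)
  have phipsi: "\<lbrace>\<phi> y, \<psi> x, a\<rbrace>\<^bsub>H\<^esub> = - \<lbrace>\<psi> x, \<phi> y, a\<rbrace>\<^bsub>H\<^esub>" for x y a by (rule H.trp_swap)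
  show ?thesis
    unfolding c nab_shift_def split_conv prod.inject
  proof (intro conjI ext, goal_cases)
    case (1 x y) show ?case by (simp add: lin chi algebra_simps)
  next
    case (2 x y z) show ?case
      by (simp add: lin phipsi T_swap[of z "\<phi> y" "\<psi> x"] H.trp_swap[of "\<phi> y" "\<phi> x"]
          H.trp_swap[of "\<psi> y" "\<psi> x"] algebra_simps)
  next
    case (3 x a) show ?case by (simp add: lin algebra_simps)
  next
    case (4 x y a) show ?case by (simp add: lin algebra_simps H.trp_swap[of "\<phi> x" a] H.trp_swap[of "\<psi> x" a])
  next
    case (5 x y a) show ?case by (simp add: lin phipsi algebra_simps)
  next
    case (6 x a b) show ?case by (simp add: lin algebra_simps)
  next
    case (7 x a b) show ?case by (simp add: lin algebra_simps)
  qed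
qed

lemma equiv_nab_equiv_rel:
  assumes "lie_yamaguti G" "lie_yamaguti H"
  shows "equiv (nab_cocycles G H) (nab_equiv_rel G H)"
proof -
  interpret G: lie_yamaguti G by fact
  interpret H: lie_yamaguti H by fact
  have zero: "Vector_Spaces.linear (scl G) (scl H) (\<lambda>_. 0)"
    using G.vector_space_axioms H.vector_space_axioms by (simp add: linear_iff_all)
  have neg: "Vector_Spaces.linear (scl G) (scl H) (\<lambda>x. - \<phi> x)"
    if "Vector_Spaces.linear (scl G) (scl H) \<phi>" for \<phi>
    using that by (simp add: linear_iff_all)
  have add: "Vector_Spaces.linear (scl G) (scl H) (\<lambda>x. \<phi> x + \<psi> x)"
    if "Vector_Spaces.linear (scl G) (scl H) \<phi>" "Vector_Spaces.linear (scl G) (scl H) \<psi>" for \<phi> \<psi>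
    using that by (simp add: linear_iff_all H.scale_right_distrib algebra_simps)
  show ?thesis
  proof (rule equivI)
    show "nab_equiv_rel G H \<subseteq> nab_cocycles G H \<times> nab_cocycles G H"
      by (auto simp: nab_equiv_rel_def)
    show "refl_on (nab_cocycles G H) (nab_equiv_rel G H)"
      unfolding refl_on_def nab_equiv_rel_def nab_equivalent_iff_shift
      using zero nab_shift_zero[OF assms(2)] by force
    show "sym (nab_equiv_rel G H)"
    proof (rule symI)
      fix c1 c2 assume "(c1, c2) \<in> nab_equiv_rel G H"
      then obtain \<phi> where \<phi>: "Vector_Spaces.linear (scl G) (scl H) \<phi>" "c1 = nab_shift G H \<phi> c2"
        and c: "c1 \<in> nab_cocycles G H" "c2 \<in> nab_cocycles G H"
        by (auto simp: nab_equiv_rel_def nab_equivalent_iff_shift)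
      have "c2 = nab_shift G H (\<lambda>x. - \<phi> x) c1"
        using \<phi> c by (simp add: nab_shift_add nab_shift_zero[OF assms(2)])
      with c neg[OF \<phi>(1)] show "(c2, c1) \<in> nab_equiv_rel G H"
        by (auto simp: nab_equiv_rel_def nab_equivalent_iff_shift)
    qed
    show "trans (nab_equiv_rel G H)"
    proof (rule transI)
      fix c1 c2 c3 assume "(c1, c2) \<in> nab_equiv_rel G H" "(c2, c3) \<in> nab_equiv_rel G H"
      then obtain \<phi> \<psi> where l: "Vector_Spaces.linear (scl G) (scl H) \<phi>" "Vector_Spaces.linear (scl G) (scl H) \<psi>"
        and "c1 = nab_shift G H \<phi> c2" "c2 = nab_shift G H \<psi> c3"
        and c: "c1 \<in> nab_cocycles G H" "c3 \<in> nab_cocycles G H"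
        by (auto simp: nab_equiv_rel_def nab_equivalent_iff_shift)
      then have "c1 = nab_shift G H (\<lambda>x. \<phi> x + \<psi> x) c3" by (simp add: nab_shift_add)
      with c add[OF l] show "(c1, c3) \<in> nab_equiv_rel G H"
        by (auto simp: nab_equiv_rel_def nab_equivalent_iff_shift)
    qed
  qed
qed

section \<open>Extensions with a section\<close>

text \<open>An extension together with a chosen linear section; it splits as a sequence of vector spaces,
  not of algebras.\<close>

locale split_extension = ly_extension H E G i p
  for H :: "('k::field, 'h::ab_group_add) ly_struct"
    and E :: "('k, 'e::ab_group_add) ly_struct"
    and G :: "('k, 'g::ab_group_add) ly_struct"
    and i :: "'h \<Rightarrow> 'e" and p :: "'e \<Rightarrow> 'g" +
  fixes s :: "'g \<Rightarrow> 'e"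
  assumes sec: "ly_section E G p s"
begin

text \<open>The coordinate of \<open>e\<close> in \<open>H\<close>.  The choice of a preimage under \<open>i\<close> is harmless, since
  \<open>e - s (p e)\<close> lies in the kernel of \<open>p\<close>.\<close>

definition q :: "'e \<Rightarrow> 'h" where "q e = inv_into UNIV i (e - s (p e))"

text \<open>The components of the induced septuple, written uniformly with \<open>q\<close>; see
  \<open>induced_cocycle_eq\<close>.\<close>

definition \<chi> where "\<chi> x y = q \<lbrakk>s x, s y\<rbrakk>\<^bsub>E\<^esub>"
definition \<omega> where "\<omega> x y z = q \<lbrace>s x, s y, s z\<rbrace>\<^bsub>E\<^esub>"
definition \<mu> where "\<mu> x a = q \<lbrakk>s x, i a\<rbrakk>\<^bsub>E\<^esub>"
definition \<theta> where "\<theta> x y a = q \<lbrace>i a, s x, s y\<rbrace>\<^bsub>E\<^esub>"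
definition D where "D x y a = q \<lbrace>s x, s y, i a\<rbrace>\<^bsub>E\<^esub>"
definition \<rho> where "\<rho> x a b = q \<lbrace>s x, i a, i b\<rbrace>\<^bsub>E\<^esub>"
definition T where "T x a b = q \<lbrace>i a, i b, s x\<rbrace>\<^bsub>E\<^esub>"

lemmas comp_defs = \<chi>_def \<omega>_def \<mu>_def \<theta>_def D_def \<rho>_def T_def

lemma s_linear: "Vector_Spaces.linear (scl G) (scl E) s"
  using sec by (simp add: ly_section_def)

lemma p_s [simp]: "p (s x) = x"
  using sec by (auto simp: ly_section_def fun_eq_iff)

lemmas i_simps = linear_map_simps[OF ly_homD(1)[OF i_hom]]
lemmas p_simps = linear_map_simps[OF ly_homD(1)[OF p_hom]]
lemmas s_simps = linear_map_simps[OF s_linear]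

lemma i_eq_iff: "i a = i b \<longleftrightarrow> a = b"
  using i_inj by (simp add: inj_eq)

lemma p_i [simp]: "p (i a) = 0"
  using exact by blast

lemma i_q: "i (q e) = e - s (p e)"
proof -
  have "e - s (p e) \<in> range i" by (simp add: exact p_simps)
  then show ?thesis unfolding q_def by (rule f_inv_into_f)
qed

lemma decomp: "e = s (p e) + i (q e)"
  by (simp add: i_q)

lemma q_unique: "i a = e - s (p e) \<Longrightarrow> q e = a"
  using i_q[of e] by (simp flip: i_eq_iff)

lemma q_s [simp]: "q (s x) = 0"
  by (rule q_unique) (simp add: i_simps)

lemma q_i [simp]: "q (i a) = a"
  by (rule q_unique) (simp add: s_simps)

lemma q_linear: "Vector_Spaces.linear (scl E) (scl H) q"
  unfolding linear_iff_all
  using E.vector_space_axioms H.vector_space_axioms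
  by (auto intro!: q_unique simp: i_simps i_q p_simps s_simps E.scale_right_diff_distrib)

lemmas q_simps = linear_map_simps[OF q_linear]

lemma inv_i_eq_q: "x = p e \<Longrightarrow> inv_into UNIV i (e - s x) = q e"
  by (simp add: q_def)

lemma inv_i_eq_q0: "p e = 0 \<Longrightarrow> inv_into UNIV i e = q e"
  by (simp add: q_def s_simps)

lemma induced_cocycle_eq: "induced_cocycle E G i s = (\<chi>, \<omega>, \<mu>, \<theta>, D, \<rho>, T)"
  by (simp add: induced_cocycle_def Let_def fun_eq_iff comp_defs inv_i_eq_q inv_i_eq_q0
      ly_homD(2,3)[OF p_hom] G.brk_simps G.trp_simps)

text \<open>The products of \<open>E\<close> in coordinates.  As rewrite rules these bring every product of vectors
  \<open>s x\<close> and \<open>i a\<close> into the form \<open>s x' \<plusminus> i a'\<close>, possibly without the first summand.\<close>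

lemma prod_coords:
  "\<lbrakk>s x, s y\<rbrakk>\<^bsub>E\<^esub> = s \<lbrakk>x, y\<rbrakk>\<^bsub>G\<^esub> + i (\<chi> x y)"
  "\<lbrakk>s x, i a\<rbrakk>\<^bsub>E\<^esub> = i (\<mu> x a)"
  "\<lbrakk>i a, s x\<rbrakk>\<^bsub>E\<^esub> = - i (\<mu> x a)"
  "\<lbrakk>i a, i b\<rbrakk>\<^bsub>E\<^esub> = i \<lbrakk>a, b\<rbrakk>\<^bsub>H\<^esub>"
  "\<lbrace>s x, s y, s z\<rbrace>\<^bsub>E\<^esub> = s \<lbrace>x, y, z\<rbrace>\<^bsub>G\<^esub> + i (\<omega> x y z)"
  "\<lbrace>i a, s x, s y\<rbrace>\<^bsub>E\<^esub> = i (\<theta> x y a)"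
  "\<lbrace>s x, i a, s y\<rbrace>\<^bsub>E\<^esub> = - i (\<theta> x y a)"
  "\<lbrace>s x, s y, i a\<rbrace>\<^bsub>E\<^esub> = i (D x y a)"
  "\<lbrace>s x, i a, i b\<rbrace>\<^bsub>E\<^esub> = i (\<rho> x a b)"
  "\<lbrace>i a, s x, i b\<rbrace>\<^bsub>E\<^esub> = - i (\<rho> x a b)"
  "\<lbrace>i a, i b, s x\<rbrace>\<^bsub>E\<^esub> = i (T x a b)"
  "\<lbrace>i a, i b, i c\<rbrace>\<^bsub>E\<^esub> = i \<lbrace>a, b, c\<rbrace>\<^bsub>H\<^esub>"
  by (simp_all add: comp_defs i_q ly_homD(2,3)[OF p_hom] ly_homD(2,3)[OF i_hom] G.brk_simps
      G.trp_simps s_simps E.brk_swap[of "i a" "s x"] E.trp_swap[of "s x" "i a" "s y"]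
      E.trp_swap[of "i a" "s x" "i b"])

lemmas coords = prod_coords E.brk_simps E.trp_simps q_simps i_simps

text \<open>Comparing \<open>q\<close>-parts turns an identity \<open>e = f\<close> of \<open>E\<close> into an identity \<open>a = b\<close> of \<open>H\<close>.\<close>

lemma from_E: "e = f \<Longrightarrow> q e - q f = a - b \<Longrightarrow> a = b"
  by simp

lemma from_E': "e = f \<Longrightarrow> q e - q f = b - a \<Longrightarrow> a = b"
  by simp

lemma T_swap: "T x a b = - T x b a"
  unfolding T_def by (subst E.trp_swap) (simp add: q_simps)

text \<open>Each Lie-Yamaguti identity of \<open>E\<close> is taken at arguments \<open>s x\<close> for the variables of \<open>G\<close> and \<open>i a\<close>
  for those of \<open>H\<close>; its \<open>q\<close>-part is a cocycle identity up to sign and skew-symmetry.\<close>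

lemma is_cocycle: "nonabelian_cocycle G H \<chi> \<omega> \<mu> \<theta> D \<rho> T"
proof unfold_locales
  note lin = bilinear_map_def trilinear_map_def linear_iff_all E.brk_simps E.trp_simps i_simps s_simps q_simps
    G.vector_space_axioms H.vector_space_axioms comp_defs
  show "bilinear_map (scl G) (scl G) (scl H) \<chi>"
      "trilinear_map (scl G) (scl G) (scl G) (scl H) \<omega>"
      "bilinear_map (scl G) (scl H) (scl H) \<mu>"
      "trilinear_map (scl G) (scl G) (scl H) (scl H) \<theta>"
      "trilinear_map (scl G) (scl G) (scl H) (scl H) D"
      "trilinear_map (scl G) (scl H) (scl H) (scl H) \<rho>"
      "trilinear_map (scl G) (scl H) (scl H) (scl H) T"
    by (simp_all add: lin)
next
  note simps = coords algebra_simps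
  {
    fix x y show "\<chi> x y + \<chi> y x = 0"
      by (rule from_E[OF E.brk_skew[of "s x" "s y"]]) (simp add: simps)
  next
    fix x y z show "\<omega> x y z + \<omega> y x z = 0"
      by (rule from_E[OF E.trp_skew[of "s x" "s y" "s z"]]) (simp add: simps)
  next
    fix x y a show "D x y a + D y x a = 0"
      by (rule from_E[OF E.trp_skew[of "s x" "s y" "i a"]]) (simp add: simps)
  next
    fix x a b show "T x a b + T x b a = 0"
      by (rule from_E[OF E.trp_skew[of "i a" "i b" "s x"]]) (simp add: simps)
  next
    fix x y z
    show "\<chi> \<lbrakk>x, y\<rbrakk>\<^bsub>G\<^esub> z - \<mu> z (\<chi> x y) + \<omega> x y z + \<chi> \<lbrakk>y, z\<rbrakk>\<^bsub>G\<^esub> x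
        - \<mu> x (\<chi> y z) + \<omega> y z x + \<chi> \<lbrakk>z, x\<rbrakk>\<^bsub>G\<^esub> y - \<mu> y (\<chi> z x) + \<omega> z x y = 0"
      by (rule from_E[OF E.brk_jacobi[of "s x" "s y" "s z"]]) (simp add: simps)
  next
    fix x y a
    show "\<mu> \<lbrakk>x, y\<rbrakk>\<^bsub>G\<^esub> a + \<lbrakk>\<chi> x y, a\<rbrakk>\<^bsub>H\<^esub> + D x y a - \<mu> x (\<mu> y a) - \<theta> y x a + \<mu> y (\<mu> x a) + \<theta> x y a = 0"
      by (rule from_E[OF E.brk_jacobi[of "s x" "s y" "i a"]]) (simp add: simps)
  next
    fix x a b
    show "\<lbrakk>\<mu> x a, b\<rbrakk>\<^bsub>H\<^esub> + \<rho> x a b - \<mu> x \<lbrakk>a, b\<rbrakk>\<^bsub>H\<^esub> + T x a b - \<lbrakk>\<mu> x b, a\<rbrakk>\<^bsub>H\<^esub> - \<rho> x b a = 0"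
      by (rule from_E[OF E.brk_jacobi[of "s x" "i a" "i b"]]) (simp add: simps)
  next
    fix x y z w
    show "\<omega> \<lbrakk>x, y\<rbrakk>\<^bsub>G\<^esub> z w + \<omega> \<lbrakk>y, z\<rbrakk>\<^bsub>G\<^esub> x w
        + \<omega> \<lbrakk>z, x\<rbrakk>\<^bsub>G\<^esub> y w + \<theta> z w (\<chi> x y) + \<theta> x w (\<chi> y z) + \<theta> y w (\<chi> z x) = 0"
      by (rule from_E[OF E.trp_cyclic[of "s x" "s y" "s z" "s w"]]) (simp add: simps)
  next
    fix x y z a
    show "D \<lbrakk>x, y\<rbrakk>\<^bsub>G\<^esub> z a - \<rho> z (\<chi> x y) a + D \<lbrakk>y, z\<rbrakk>\<^bsub>G\<^esub> x a - \<rho> x (\<chi> y z) a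
        + D \<lbrakk>z, x\<rbrakk>\<^bsub>G\<^esub> y a - \<rho> y (\<chi> z x) a = 0"
      by (rule from_E[OF E.trp_cyclic[of "s x" "s y" "s z" "i a"]]) (simp add: simps)
  next
    fix x y z a
    show "\<theta> \<lbrakk>x, y\<rbrakk>\<^bsub>G\<^esub> z a - T z (\<chi> x y) a - \<theta> x z (\<mu> y a) + \<theta> y z (\<mu> x a) = 0"
      by (rule from_E'[OF E.trp_cyclic[of "s x" "s y" "i a" "s z"]]) (simp add: simps)
  next
    fix x y a b
    show "\<rho> \<lbrakk>x, y\<rbrakk>\<^bsub>G\<^esub> a b + \<lbrace>\<chi> x y, a, b\<rbrace>\<^bsub>H\<^esub> - \<rho> x (\<mu> y a) b + \<rho> y (\<mu> x a) b = 0"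
      by (rule from_E[OF E.trp_cyclic[of "s x" "s y" "i a" "i b"]]) (simp add: simps)
  next
    fix x y a b
    show "T y (\<mu> x a) b + \<theta> x y \<lbrakk>a, b\<rbrakk>\<^bsub>H\<^esub> - T y (\<mu> x b) a = 0"
      by (rule from_E[OF E.trp_cyclic[of "s x" "i a" "i b" "s y"]]) (simp add: simps)
  next
    fix x a b c
    show "\<lbrace>\<mu> x a, b, c\<rbrace>\<^bsub>H\<^esub> - \<rho> x \<lbrakk>a, b\<rbrakk>\<^bsub>H\<^esub> c - \<lbrace>\<mu> x b, a, c\<rbrace>\<^bsub>H\<^esub> = 0"
      by (rule from_E[OF E.trp_cyclic[of "s x" "i a" "i b" "i c"]]) (simp add: simps)
  next
    fix x a b c
    show "T x \<lbrakk>a, b\<rbrakk>\<^bsub>H\<^esub> c + T x \<lbrakk>b, c\<rbrakk>\<^bsub>H\<^esub> a + T x \<lbrakk>c, a\<rbrakk>\<^bsub>H\<^esub> b = 0"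
      by (rule from_E[OF E.trp_cyclic[of "i a" "i b" "i c" "s x"]]) (simp add: simps)
  next
    fix x y z w
    show "\<omega> x y \<lbrakk>z, w\<rbrakk>\<^bsub>G\<^esub> + D x y (\<chi> z w) = \<chi> \<lbrace>x, y, z\<rbrace>\<^bsub>G\<^esub> w
        - \<mu> w (\<omega> x y z) + \<mu> z (\<omega> x y w) + \<chi> z \<lbrace>x, y, w\<rbrace>\<^bsub>G\<^esub>"
      by (rule from_E[OF E.trp_brk[of "s x" "s y" "s z" "s w"]]) (simp add: simps)
  next
    fix x y z a
    show "D x y (\<mu> z a) = \<mu> \<lbrace>x, y, z\<rbrace>\<^bsub>G\<^esub> a + \<lbrakk>\<omega> x y z, a\<rbrakk>\<^bsub>H\<^esub> + \<mu> z (D x y a)"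
      by (rule from_E[OF E.trp_brk[of "s x" "s y" "s z" "i a"]]) (simp add: simps)
  next
    fix x y z a
    show "\<theta> x \<lbrakk>y, z\<rbrakk>\<^bsub>G\<^esub> a - \<rho> x a (\<chi> y z) = \<mu> y (\<theta> x z a) - \<mu> z (\<theta> x y a)"
      by (rule from_E[OF E.trp_brk[of "i a" "s x" "s y" "s z"]]) (simp add: simps)
  next
    fix x y a b
    show "D x y \<lbrakk>a, b\<rbrakk>\<^bsub>H\<^esub> = \<lbrakk>D x y a, b\<rbrakk>\<^bsub>H\<^esub> + \<lbrakk>a, D x y b\<rbrakk>\<^bsub>H\<^esub>"
      by (rule from_E[OF E.trp_brk[of "s x" "s y" "i a" "i b"]]) (simp add: simps)
  next
    fix x y a b
    show "\<rho> x a (\<mu> y b) + \<lbrakk>\<theta> x y a, b\<rbrakk>\<^bsub>H\<^esub> - \<mu> y (\<rho> x a b) = 0"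
      by (rule from_E[OF E.trp_brk[of "s x" "i a" "s y" "i b"]]) (simp add: simps)
  next
    fix x y a b
    show "T \<lbrakk>x, y\<rbrakk>\<^bsub>G\<^esub> a b + \<lbrace>a, b, \<chi> x y\<rbrace>\<^bsub>H\<^esub> - \<mu> x (T y a b) + \<mu> y (T x a b) = 0"
      by (rule from_E[OF E.trp_brk[of "i a" "i b" "s x" "s y"]]) (simp add: simps)
  next
    fix x a b c
    show "\<lbrace>a, b, \<mu> x c\<rbrace>\<^bsub>H\<^esub> = \<mu> x \<lbrace>a, b, c\<rbrace>\<^bsub>H\<^esub> - \<lbrakk>c, T x a b\<rbrakk>\<^bsub>H\<^esub>"
      by (rule from_E[OF E.trp_brk[of "i a" "i b" "s x" "i c"]])
        (simp add: simps H.brk_swap[of c "T x a b"])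
  next
    fix x a b c
    show "\<rho> x a \<lbrakk>b, c\<rbrakk>\<^bsub>H\<^esub> = \<lbrakk>\<rho> x a b, c\<rbrakk>\<^bsub>H\<^esub> + \<lbrakk>b, \<rho> x a c\<rbrakk>\<^bsub>H\<^esub>"
      by (rule from_E[OF E.trp_brk[of "s x" "i a" "i b" "i c"]]) (simp add: simps)
  next
    fix x1 x2 y1 y2 y3
    show "D x1 x2 (\<omega> y1 y2 y3) + \<omega> x1 x2 \<lbrace>y1, y2, y3\<rbrace>\<^bsub>G\<^esub>
        = \<omega> \<lbrace>x1, x2, y1\<rbrace>\<^bsub>G\<^esub> y2 y3 + \<theta> y2 y3 (\<omega> x1 x2 y1)
        + \<omega> y1 \<lbrace>x1, x2, y2\<rbrace>\<^bsub>G\<^esub> y3 - \<theta> y1 y3 (\<omega> x1 x2 y2)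
        + \<omega> y1 y2 \<lbrace>x1, x2, y3\<rbrace>\<^bsub>G\<^esub> + D y1 y2 (\<omega> x1 x2 y3)"
      by (rule from_E[OF E.trp_trp[of "s x1" "s x2" "s y1" "s y2" "s y3"]]) (simp add: simps)
  next
    fix x y z w a
    show "D x y (\<theta> z w a) - \<theta> z w (D x y a) = \<theta> \<lbrace>x, y, z\<rbrace>\<^bsub>G\<^esub> w a
        + \<theta> z \<lbrace>x, y, w\<rbrace>\<^bsub>G\<^esub> a - T w (\<omega> x y z) a - \<rho> z a (\<omega> x y w)"
      by (rule from_E[OF E.trp_trp[of "s x" "s y" "i a" "s z" "s w"]])
        (simp add: simps T_swap[of w a "\<omega> x y z"])
  next
    fix x y z w a
    show "\<theta> x \<lbrace>y, z, w\<rbrace>\<^bsub>G\<^esub> a - \<rho> x a (\<omega> y z w) = \<theta> z w (\<theta> x y a) - \<theta> y w (\<theta> x z a) + D y z (\<theta> x w a)"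
      by (rule from_E[OF E.trp_trp[of "i a" "s x" "s y" "s z" "s w"]]) (simp add: simps)
  next
    fix x y z w a
    show "D x y (D z w a) - D z w (D x y a) = D \<lbrace>x, y, z\<rbrace>\<^bsub>G\<^esub> w a + D z \<lbrace>x, y, w\<rbrace>\<^bsub>G\<^esub> a - \<rho> w (\<omega> x y z) a + \<rho> z (\<omega> x y w) a"
      by (rule from_E[OF E.trp_trp[of "s x" "s y" "s z" "s w" "i a"]]) (simp add: simps)
  next
    fix x y z a b
    show "D x y (\<rho> z a b) - \<rho> \<lbrace>x, y, z\<rbrace>\<^bsub>G\<^esub> a b = \<rho> z (D x y a) b + \<rho> z a (D x y b) + \<lbrace>\<omega> x y z, a, b\<rbrace>\<^bsub>H\<^esub>"
      by (rule from_E[OF E.trp_trp[of "s x" "s y" "s z" "i a" "i b"]]) (simp add: simps)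
  next
    fix x y z a b
    show "D y z (\<rho> x a b) = \<rho> x a (D y z b) - \<rho> z (\<theta> x y a) b + \<rho> y (\<theta> x z a) b"
      by (rule from_E'[OF E.trp_trp[of "s x" "i a" "s y" "s z" "i b"]]) (simp add: simps)
  next
    fix x y z a b
    show "\<theta> y z (\<rho> x a b) = \<rho> x a (\<theta> y z b) - T z (\<theta> x y a) b - \<rho> y b (\<theta> x z a)"
      by (rule from_E'[OF E.trp_trp[of "s x" "i a" "i b" "s y" "s z"]])
        (simp add: simps T_swap[of z b "\<theta> x y a"])
  next
    fix x y z a b
    show "D x y (T z a b) - T \<lbrace>x, y, z\<rbrace>\<^bsub>G\<^esub> a b = T z (D x y a) b + T z a (D x y b) + \<lbrace>a, b, \<omega> x y z\<rbrace>\<^bsub>H\<^esub>"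
      by (rule from_E[OF E.trp_trp[of "s x" "s y" "i a" "i b" "s z"]]) (simp add: simps)
  next
    fix x y z a b
    show "T \<lbrace>x, y, z\<rbrace>\<^bsub>G\<^esub> a b - D x y (T z a b) + \<lbrace>a, b, \<omega> x y z\<rbrace>\<^bsub>H\<^esub> = \<theta> y z (T x a b) - \<theta> x z (T y a b)"
      by (rule from_E[OF E.trp_trp[of "i a" "i b" "s x" "s y" "s z"]]) (simp add: simps)
  next
    fix x y a b c
    show "D x y \<lbrace>a, b, c\<rbrace>\<^bsub>H\<^esub> = \<lbrace>D x y a, b, c\<rbrace>\<^bsub>H\<^esub> + \<lbrace>a, D x y b, c\<rbrace>\<^bsub>H\<^esub>
        + \<lbrace>a, b, D x y c\<rbrace>\<^bsub>H\<^esub>"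
      by (rule from_E[OF E.trp_trp[of "s x" "s y" "i a" "i b" "i c"]]) (simp add: simps)
  next
    fix x y a b c
    show "\<rho> x a (\<rho> y b c) = \<rho> y (\<rho> x a b) c + \<rho> y b (\<rho> x a c) - \<lbrace>\<theta> x y a, b, c\<rbrace>\<^bsub>H\<^esub>"
      by (rule from_E[OF E.trp_trp[of "s x" "i a" "s y" "i b" "i c"]]) (simp add: simps)
  next
    fix x y a b c
    show "\<lbrace>a, b, \<theta> x y c\<rbrace>\<^bsub>H\<^esub> = \<theta> x y \<lbrace>a, b, c\<rbrace>\<^bsub>H\<^esub> - T y (T x a b) c - \<rho> x c (T y a b)"
      by (rule from_E[OF E.trp_trp[of "i a" "i b" "i c" "s x" "s y"]])
        (simp add: simps T_swap[of y c "T x a b"])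
  next
    fix x y a b c
    show "\<rho> x a (T y b c) = T y (\<rho> x a b) c + T y b (\<rho> x a c) - \<lbrace>b, c, \<theta> x y a\<rbrace>\<^bsub>H\<^esub>"
      by (rule from_E[OF E.trp_trp[of "s x" "i a" "i b" "i c" "s y"]]) (simp add: simps)
  next
    fix x y a b c
    show "\<lbrace>a, b, D x y c\<rbrace>\<^bsub>H\<^esub> = D x y \<lbrace>a, b, c\<rbrace>\<^bsub>H\<^esub> - \<rho> y (T x a b) c + \<rho> x (T y a b) c"
      by (rule from_E[OF E.trp_trp[of "i a" "i b" "s x" "s y" "i c"]]) (simp add: simps)
  next
    fix x a b c d
    show "\<lbrace>a, b, \<rho> x c d\<rbrace>\<^bsub>H\<^esub> = \<rho> x \<lbrace>a, b, c\<rbrace>\<^bsub>H\<^esub> d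
        - \<lbrace>c, T x a b, d\<rbrace>\<^bsub>H\<^esub> + \<rho> x c \<lbrace>a, b, d\<rbrace>\<^bsub>H\<^esub>"
      by (rule from_E[OF E.trp_trp[of "i a" "i b" "s x" "i c" "i d"]])
        (simp add: simps H.trp_swap[of c "T x a b"])
  next
    fix x a b c d
    show "\<rho> x a \<lbrace>b, c, d\<rbrace>\<^bsub>H\<^esub> = \<lbrace>\<rho> x a b, c, d\<rbrace>\<^bsub>H\<^esub>
        + \<lbrace>b, \<rho> x a c, d\<rbrace>\<^bsub>H\<^esub> + \<lbrace>b, c, \<rho> x a d\<rbrace>\<^bsub>H\<^esub>"
      by (rule from_E[OF E.trp_trp[of "s x" "i a" "i b" "i c" "i d"]]) (simp add: simps)
  next
    fix x a b c d
    show "\<lbrace>a, b, T x c d\<rbrace>\<^bsub>H\<^esub> = T x \<lbrace>a, b, c\<rbrace>\<^bsub>H\<^esub> d + T x c \<lbrace>a, b, d\<rbrace>\<^bsub>H\<^esub>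
        + \<lbrace>c, d, T x a b\<rbrace>\<^bsub>H\<^esub>"
      by (rule from_E[OF E.trp_trp[of "i a" "i b" "i c" "i d" "s x"]]) (simp add: simps)
  }
qed

lemma induced_in_cocycles: "induced_cocycle E G i s \<in> nab_cocycles G H"
  using is_cocycle by (simp add: induced_cocycle_eq nab_cocycles_def)


lemma section_differs_by_linear:
  assumes "ly_section E G p s'"
  shows "\<exists>\<phi>. Vector_Spaces.linear (scl G) (scl H) \<phi> \<and> (\<forall>x. s' x = s x - i (\<phi> x))"
proof (intro exI conjI allI)
  have s': "Vector_Spaces.linear (scl G) (scl E) s'" "p (s' x) = x" for x
    using assms by (auto simp: ly_section_def fun_eq_iff)
  show "Vector_Spaces.linear (scl G) (scl H) (\<lambda>x. - q (s' x))"
    using G.vector_space_axioms H.vector_space_axioms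
    by (simp add: linear_iff_all linear_map_simps[OF s'(1)] q_simps)
  show "s' x = s x - i (- q (s' x))" for x
    by (simp add: i_simps i_q s')
qed

lemma shifted_section:
  assumes "Vector_Spaces.linear (scl G) (scl H) \<phi>"
  shows "split_extension H E G i p (\<lambda>x. s x - i (\<phi> x))"
proof unfold_locales
  show "ly_section E G p (\<lambda>x. s x - i (\<phi> x))"
    unfolding ly_section_def linear_iff_all
    using G.vector_space_axioms E.vector_space_axioms
    by (auto simp: fun_eq_iff p_simps s_simps i_simps linear_map_simps[OF assms]
        E.scale_right_diff_distrib)
qed

lemma induced_cocycle_shifted_section:
  assumes "Vector_Spaces.linear (scl G) (scl H) \<phi>"
  shows "induced_cocycle E G i (\<lambda>x. s x - i (\<phi> x)) = nab_shift G H \<phi> (induced_cocycle E G i s)"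
proof -
  interpret S: split_extension H E G i p "\<lambda>x. s x - i (\<phi> x)"
    using assms by (rule shifted_section)
  have q: "S.q e = q e + \<phi> (p e)" for e
    by (rule S.q_unique) (simp add: i_simps i_q algebra_simps)
  have p: "p \<lbrakk>e, f\<rbrakk>\<^bsub>E\<^esub> = \<lbrakk>p e, p f\<rbrakk>\<^bsub>G\<^esub>" "p \<lbrace>e, f, g\<rbrace>\<^bsub>E\<^esub> = \<lbrace>p e, p f, p g\<rbrace>\<^bsub>G\<^esub>" for e f g
    by (rule ly_homD[OF p_hom])+
  note simps = S.comp_defs q p p_simps G.brk_simps G.trp_simps linear_map_simps[OF assms] coords
  show ?thesis
    unfolding S.induced_cocycle_eq induced_cocycle_eq nab_shift_def split_conv prod.inject
  proof (intro conjI ext, goal_cases)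
    case (1 x y) show ?case by (simp add: simps algebra_simps)
  next
    case (2 x y z) show ?case by (simp add: simps algebra_simps)
  next
    case (3 x a) show ?case by (simp add: simps algebra_simps H.brk_swap[of "\<phi> x" a])
  next
    case (4 x y a) show ?case by (simp add: simps algebra_simps)
  next
    case (5 x y a) show ?case by (simp add: simps algebra_simps)
  next
    case (6 x a b) show ?case by (simp add: simps algebra_simps H.trp_swap[of "\<phi> x" a])
  next
    case (7 x a b) show ?case by (simp add: simps algebra_simps H.trp_swap[of a b])
  qed
qed

end

section \<open>Isomorphisms of extensions and induced cocycles\<close>

lemma induced_cocycle_iso:
  assumes "split_extension H E G i p s" "split_extension H E' G i' p' s'"
    and \<gamma>: "\<gamma> \<in> ly_hom E E'" and \<gamma>s: "\<And>x. \<gamma> (s x) = s' x" and \<gamma>i: "\<And>a. \<gamma> (i a) = i' a"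
  shows "induced_cocycle E G i s = induced_cocycle E' G i' s'"
proof -
  interpret A: split_extension H E G i p s by fact
  interpret B: split_extension H E' G i' p' s' by fact
  note lin = linear_map_simps[OF ly_homD(1)[OF \<gamma>]]
  have \<gamma>_eq: "\<gamma> e = s' (p e) + i' (A.q e)" for e
    by (subst A.decomp[of e]) (simp add: lin \<gamma>s \<gamma>i)
  have q: "A.q e = B.q (\<gamma> e)" for e
    unfolding \<gamma>_eq by (simp add: B.q_simps)
  show ?thesis
    unfolding A.induced_cocycle_eq B.induced_cocycle_eq
    by (simp add: fun_eq_iff A.comp_defs B.comp_defs q ly_homD(2,3)[OF \<gamma>] \<gamma>s \<gamma>i)
qed

text \<open>Conversely, the septuple determines the products of \<open>E\<close> in coordinates, so the linear map
  that matches the coordinates is an isomorphism.\<close>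

lemma iso_of_induced_cocycle_eq:
  assumes "split_extension H E G i p s" "split_extension H E' G i' p' s'"
    and eq: "induced_cocycle E G i s = induced_cocycle E' G i' s'"
  obtains \<gamma> where "\<gamma> \<in> ly_hom E E'" "bij \<gamma>" "\<And>x. \<gamma> (s x) = s' x" "\<And>a. \<gamma> (i a) = i' a"
proof -
  interpret A: split_extension H E G i p s by fact
  interpret B: split_extension H E' G i' p' s' by fact
  define \<gamma> where "\<gamma> e = s' (p e) + i' (A.q e)" for e
  have \<gamma>s: "\<gamma> (s x) = s' x" and \<gamma>i: "\<gamma> (i a) = i' a" for x a
    by (simp_all add: \<gamma>_def B.s_simps B.i_simps)
  have lin: "Vector_Spaces.linear (scl E) (scl E') \<gamma>"
    using A.E.vector_space_axioms B.E.vector_space_axioms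
    by (simp add: linear_iff_all \<gamma>_def A.p_simps A.q_simps B.s_simps B.i_simps
        B.E.scale_right_distrib algebra_simps)
  have comps: "A.\<chi> = B.\<chi>" "A.\<omega> = B.\<omega>" "A.\<mu> = B.\<mu>" "A.\<theta> = B.\<theta>" "A.D = B.D" "A.\<rho> = B.\<rho>" "A.T = B.T"
    using eq by (simp_all add: A.induced_cocycle_eq B.induced_cocycle_eq)
  note simps = linear_map_simps[OF lin] \<gamma>s \<gamma>i A.coords B.coords comps
  have brk: "\<gamma> \<lbrakk>s x + i a, s y + i b\<rbrakk>\<^bsub>E\<^esub> = \<lbrakk>s' x + i' a, s' y + i' b\<rbrakk>\<^bsub>E'\<^esub>" for x a y b
    by (simp add: simps)
  have trp: "\<gamma> \<lbrace>s x + i a, s y + i b, s z + i c\<rbrace>\<^bsub>E\<^esub> = \<lbrace>s' x + i' a, s' y + i' b, s' z + i' c\<rbrace>\<^bsub>E'\<^esub>"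
    for x a y b z c
    by (simp add: simps)
  have "\<gamma> \<in> ly_hom E E'"
    unfolding ly_hom_def
  proof (intro CollectI conjI allI lin)
    show "\<gamma> \<lbrakk>e, f\<rbrakk>\<^bsub>E\<^esub> = \<lbrakk>\<gamma> e, \<gamma> f\<rbrakk>\<^bsub>E'\<^esub>" for e f
      using brk[of "p e" "A.q e" "p f" "A.q f"] by (simp flip: A.decomp \<gamma>_def)
    show "\<gamma> \<lbrace>e, f, g\<rbrace>\<^bsub>E\<^esub> = \<lbrace>\<gamma> e, \<gamma> f, \<gamma> g\<rbrace>\<^bsub>E'\<^esub>" for e f g
      using trp[of "p e" "A.q e" "p f" "A.q f" "p g" "A.q g"] by (simp flip: A.decomp \<gamma>_def)
  qed
  moreover have "bij \<gamma>"
  proof (rule bijI')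
    fix e f
    have pq: "p' (\<gamma> e) = p e" "B.q (\<gamma> e) = A.q e" for e
      by (simp_all add: \<gamma>_def B.p_simps B.q_simps)
    show "\<gamma> e = \<gamma> f \<longleftrightarrow> e = f"
    proof
      assume "\<gamma> e = \<gamma> f"
      then have "p e = p f" "A.q e = A.q f" using pq[of e] pq[of f] by simp_all
      then have "s (p e) + i (A.q e) = s (p f) + i (A.q f)" by simp
      then show "e = f" by (simp flip: A.decomp)
    qed simp
  next
    fix f
    have "f = \<gamma> (s (p' f) + i (B.q f))"
      by (simp add: linear_map_simps[OF lin] \<gamma>s \<gamma>i flip: B.decomp)
    then show "\<exists>e. f = \<gamma> e" ..
  qed
  ultimately show thesis using \<gamma>s \<gamma>i that by blast
qed

text \<open>Twisting the injection by \<open>\<beta>\<^sup>-\<^sup>1\<close> and the projection by \<open>\<alpha>\<close> gives another extension of \<open>G\<close>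
  by \<open>H\<close> with the same middle algebra.\<close>

lemma (in split_extension) twisted_extension:
  assumes \<alpha>: "\<alpha> \<in> carrier (ly_Aut G)" and \<beta>: "\<beta> \<in> carrier (ly_Aut H)"
  shows "split_extension H E G (i \<circ> inv_into UNIV \<beta>) (\<alpha> \<circ> p) (s \<circ> inv_into UNIV \<alpha>)"
proof -
  note \<alpha>' = inv_into_in_ly_Aut[OF \<alpha>] and \<beta>' = inv_into_in_ly_Aut[OF \<beta>]
  have inv: "\<alpha> (inv_into UNIV \<alpha> x) = x" for x
    using \<alpha> by (simp add: carrier_ly_Aut bij_def surj_f_inv_f)
  show ?thesis
  proof unfold_locales
    show "i \<circ> inv_into UNIV \<beta> \<in> ly_hom H E" "\<alpha> \<circ> p \<in> ly_hom E G"
      using \<alpha> \<beta>' i_hom p_hom by (auto simp: carrier_ly_Aut intro: ly_hom_comp)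
    show "inj (i \<circ> inv_into UNIV \<beta>)"
      using \<beta>' by (intro inj_compose i_inj) (simp add: carrier_ly_Aut bij_def)
    show "surj (\<alpha> \<circ> p)"
      using \<alpha> by (intro comp_surj p_surj) (simp add: carrier_ly_Aut bij_def)
    have "range (inv_into UNIV \<beta>) = UNIV" using \<beta>' by (simp add: carrier_ly_Aut bij_def)
    then have "range (i \<circ> inv_into UNIV \<beta>) = range i" by (metis image_comp)
    moreover have "\<alpha> x = 0 \<longleftrightarrow> x = 0" for x
      using \<alpha> linear_map_simps(4)[OF ly_homD(1), of \<alpha> G G]
      by (metis carrier_ly_Aut bij_def injD)
    ultimately show "range (i \<circ> inv_into UNIV \<beta>) = (\<alpha> \<circ> p) -` {0}"
      using exact by auto
    have "Vector_Spaces.linear (scl G) (scl G) (inv_into UNIV \<alpha>)"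
      using \<alpha>' by (auto simp: carrier_ly_Aut dest: ly_homD)
    then show "ly_section E G (\<alpha> \<circ> p) (s \<circ> inv_into UNIV \<alpha>)"
      using s_linear by (simp add: ly_section_def linear_iff_all fun_eq_iff inv)
  qed
qed

lemma (in split_extension) twist_induced_cocycle:
  assumes \<alpha>: "\<alpha> \<in> carrier (ly_Aut G)" and \<beta>: "\<beta> \<in> carrier (ly_Aut H)"
  shows "twist \<alpha> \<beta> (induced_cocycle E G i s)
    = induced_cocycle E G (i \<circ> inv_into UNIV \<beta>) (s \<circ> inv_into UNIV \<alpha>)"
proof -
  interpret W: split_extension H E G "i \<circ> inv_into UNIV \<beta>" "\<alpha> \<circ> p" "s \<circ> inv_into UNIV \<alpha>"
    using assms by (rule twisted_extension)
  have "inv_into UNIV \<alpha> (\<alpha> x) = x" "inv_into UNIV \<beta> (\<beta> a) = a" for x a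
    using assms by (simp_all add: carrier_ly_Aut bij_def)
  then have q: "W.q e = \<beta> (q e)" for e
    by (intro W.q_unique) (simp add: i_q)
  show ?thesis
    unfolding W.induced_cocycle_eq induced_cocycle_eq
    by (simp add: twist_def Let_def fun_eq_iff W.comp_defs comp_defs q)
qed

section \<open>The Wells sequence\<close>

lemma carrier_Aut_h:
  "\<gamma> \<in> carrier (Aut_h E i) \<longleftrightarrow> \<gamma> \<in> carrier (ly_Aut E) \<and> \<gamma> ` range i = range i"
  by (simp add: Aut_h_def)

lemma mult_Aut_h [simp]: "\<gamma> \<otimes>\<^bsub>Aut_h E i\<^esub> \<delta> = \<gamma> \<circ> \<delta>"
  by (simp add: Aut_h_def ly_Aut_def)

lemma one_Aut_h [simp]: "\<one>\<^bsub>Aut_h E i\<^esub> = id"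
  by (simp add: Aut_h_def ly_Aut_def)

context split_extension
begin

lemma group_Aut_h: "group (Aut_h E i)"
proof -
  interpret A: group "ly_Aut E" by (rule E.group_ly_Aut)
  have "subgroup {\<gamma> \<in> carrier (ly_Aut E). \<gamma> ` range i = range i} (ly_Aut E)"
  proof (rule A.subgroupI)
    show "{\<gamma> \<in> carrier (ly_Aut E). \<gamma> ` range i = range i} \<noteq> {}"
      using E.ly_hom_id by (auto simp: carrier_ly_Aut intro!: exI[of _ id])
  next
    fix \<gamma> assume \<gamma>: "\<gamma> \<in> {\<gamma> \<in> carrier (ly_Aut E). \<gamma> ` range i = range i}"
    then have "inv_into UNIV \<gamma> ` range i = range i"
      by (metis (mono_tags, lifting) bij_def carrier_ly_Aut image_inv_f_f mem_Collect_eq)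
    with \<gamma> show "inv\<^bsub>ly_Aut E\<^esub> \<gamma> \<in> {\<gamma> \<in> carrier (ly_Aut E). \<gamma> ` range i = range i}"
      by (simp add: E.m_inv_ly_Aut inv_into_in_ly_Aut)
  next
    fix \<gamma> \<delta>
    assume "\<gamma> \<in> {\<gamma> \<in> carrier (ly_Aut E). \<gamma> ` range i = range i}"
      "\<delta> \<in> {\<gamma> \<in> carrier (ly_Aut E). \<gamma> ` range i = range i}"
    then have "\<gamma> \<in> carrier (ly_Aut E)" "\<delta> \<in> carrier (ly_Aut E)"
      and "(\<gamma> \<circ> \<delta>) ` range i = range i"
      by (simp_all only: image_comp[symmetric] mem_Collect_eq)
    then show "\<gamma> \<otimes>\<^bsub>ly_Aut E\<^esub> \<delta> \<in> {\<gamma> \<in> carrier (ly_Aut E). \<gamma> ` range i = range i}"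
      using A.m_closed[of \<gamma> \<delta>] by simp
  qed auto
  then show ?thesis unfolding Aut_h_def by (rule A.subgroup_imp_group)
qed

text \<open>The second equation shows that the first component of \<open>K\<close> does not depend on the section.\<close>

lemma K_map_intertwines:
  assumes "\<gamma> \<in> carrier (Aut_h E i)" and "K_map i p s \<gamma> = (\<alpha>, \<beta>)"
  shows "\<gamma> (i a) = i (\<beta> a)" and "p (\<gamma> e) = \<alpha> (p e)"
proof -
  have \<gamma>: "\<gamma> \<in> ly_hom E E" "\<gamma> ` range i = range i" and K: "\<alpha> = p \<circ> \<gamma> \<circ> s" "\<beta> = inv_into UNIV i \<circ> \<gamma> \<circ> i"
    using assms by (auto simp: carrier_Aut_h carrier_ly_Aut K_map_def)
  have r: "\<gamma> (i a) \<in> range i" for a using \<gamma>(2) by blast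
  then show "\<gamma> (i a) = i (\<beta> a)" by (simp add: K f_inv_into_f)
  obtain b where "\<gamma> (i (q e)) = i b" using r by blast
  then have "p (\<gamma> (s (p e) + i (q e))) = \<alpha> (p e)"
    by (simp add: K linear_map_simps[OF ly_homD(1)[OF \<gamma>(1)]] p_simps)
  then show "p (\<gamma> e) = \<alpha> (p e)" by (simp flip: decomp)
qed

lemma K_map_comp:
  assumes "\<gamma> \<in> carrier (Aut_h E i)" "\<delta> \<in> carrier (Aut_h E i)"
    and K: "K_map i p s \<gamma> = (\<alpha>, \<beta>)" "K_map i p s \<delta> = (\<alpha>', \<beta>')"
  shows "K_map i p s (\<gamma> \<circ> \<delta>) = (\<alpha> \<circ> \<alpha>', \<beta> \<circ> \<beta>')"
  using i_inj
  by (simp add: K_map_def fun_eq_iff K_map_intertwines[OF assms(1) K(1)]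
      K_map_intertwines[OF assms(2) K(2)])

lemma K_map_id: "K_map i p s id = (id, id)"
  using i_inj by (simp add: K_map_def fun_eq_iff)

lemma K_map_components_hom:
  assumes "\<gamma> \<in> carrier (Aut_h E i)" and "K_map i p s \<gamma> = (\<alpha>, \<beta>)"
  shows "\<alpha> \<in> ly_hom G G" and "\<beta> \<in> ly_hom H H"
proof -
  note it = K_map_intertwines[OF assms]
  have \<gamma>: "\<gamma> \<in> ly_hom E E" using assms by (simp add: carrier_Aut_h carrier_ly_Aut)
  note \<gamma>_simps = linear_map_simps[OF ly_homD(1)[OF \<gamma>]] ly_homD(2,3)[OF \<gamma>]
  note p_homs = ly_homD(2,3)[OF p_hom] and i_homs = ly_homD(2,3)[OF i_hom]
  have \<alpha>: "\<alpha> x = p (\<gamma> (s x))" for x by (simp add: it)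
  have "\<alpha> \<lbrakk>x, y\<rbrakk>\<^bsub>G\<^esub> = \<lbrakk>\<alpha> x, \<alpha> y\<rbrakk>\<^bsub>G\<^esub>" for x y
    using it(2)[of "\<lbrakk>s x, s y\<rbrakk>\<^bsub>E\<^esub>"] by (simp add: \<gamma>_simps p_homs flip: \<alpha>)
  moreover have "\<alpha> \<lbrace>x, y, z\<rbrace>\<^bsub>G\<^esub> = \<lbrace>\<alpha> x, \<alpha> y, \<alpha> z\<rbrace>\<^bsub>G\<^esub>" for x y z
    using it(2)[of "\<lbrace>s x, s y, s z\<rbrace>\<^bsub>E\<^esub>"] by (simp add: \<gamma>_simps p_homs flip: \<alpha>)
  ultimately show "\<alpha> \<in> ly_hom G G"
    using G.vector_space_axioms
    by (simp add: ly_hom_def linear_iff_all) (simp add: \<alpha> s_simps p_simps \<gamma>_simps)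
  have \<beta>: "\<beta> a = q (\<gamma> (i a))" for a by (simp add: it)
  have "\<beta> \<lbrakk>a, b\<rbrakk>\<^bsub>H\<^esub> = \<lbrakk>\<beta> a, \<beta> b\<rbrakk>\<^bsub>H\<^esub>" for a b
    using it(1)[of "\<lbrakk>a, b\<rbrakk>\<^bsub>H\<^esub>"] by (simp add: \<gamma>_simps i_homs it(1)) (simp add: i_eq_iff flip: i_homs)
  moreover have "\<beta> \<lbrace>a, b, c\<rbrace>\<^bsub>H\<^esub> = \<lbrace>\<beta> a, \<beta> b, \<beta> c\<rbrace>\<^bsub>H\<^esub>" for a b c
    using it(1)[of "\<lbrace>a, b, c\<rbrace>\<^bsub>H\<^esub>"] by (simp add: \<gamma>_simps i_homs it(1)) (simp add: i_eq_iff flip: i_homs)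
  ultimately show "\<beta> \<in> ly_hom H H"
    using H.vector_space_axioms
    by (simp add: ly_hom_def linear_iff_all) (simp add: \<beta> i_simps q_simps \<gamma>_simps)
qed

lemma K_map_carrier:
  assumes \<gamma>: "\<gamma> \<in> carrier (Aut_h E i)" and K: "K_map i p s \<gamma> = (\<alpha>, \<beta>)"
  shows "\<alpha> \<in> carrier (ly_Aut G)" and "\<beta> \<in> carrier (ly_Aut H)"
proof -
  interpret A: group "Aut_h E i" by (rule group_Aut_h)
  \<comment> \<open>bijectivity of the components comes from the image of the inverse of \<open>\<gamma>\<close>\<close>
  obtain \<delta> where \<delta>: "\<delta> \<in> carrier (Aut_h E i)" "\<delta> \<circ> \<gamma> = id" "\<gamma> \<circ> \<delta> = id"
    using A.Units_eq \<gamma> unfolding Units_def by auto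
  obtain \<alpha>' \<beta>' where K': "K_map i p s \<delta> = (\<alpha>', \<beta>')" by (meson surj_pair)
  have "\<alpha>' \<circ> \<alpha> = id" "\<beta>' \<circ> \<beta> = id" "\<alpha> \<circ> \<alpha>' = id" "\<beta> \<circ> \<beta>' = id"
    using K_map_comp[OF \<delta>(1) \<gamma> K' K] K_map_comp[OF \<gamma> \<delta>(1) K K'] \<delta> K_map_id by auto
  then show "\<alpha> \<in> carrier (ly_Aut G)" "\<beta> \<in> carrier (ly_Aut H)"
    using K_map_components_hom[OF \<gamma> K] by (auto simp: carrier_ly_Aut intro: o_bij)
qed

lemma group_hom_K_map: "group_hom (Aut_h E i) (ly_Aut G \<times>\<times> ly_Aut H) (K_map i p s)"
proof (intro group_hom.intro group_hom_axioms.intro group_Aut_h DirProd_group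
    G.group_ly_Aut H.group_ly_Aut homI)
  fix \<gamma> assume \<gamma>: "\<gamma> \<in> carrier (Aut_h E i)"
  obtain \<alpha> \<beta> where K: "K_map i p s \<gamma> = (\<alpha>, \<beta>)" by (meson surj_pair)
  show "K_map i p s \<gamma> \<in> carrier (ly_Aut G \<times>\<times> ly_Aut H)"
    using K_map_carrier[OF \<gamma> K] by (simp add: K)
  fix \<delta> assume \<delta>: "\<delta> \<in> carrier (Aut_h E i)"
  obtain \<alpha>' \<beta>' where K': "K_map i p s \<delta> = (\<alpha>', \<beta>')" by (meson surj_pair)
  show "K_map i p s (\<gamma> \<otimes>\<^bsub>Aut_h E i\<^esub> \<delta>)
      = K_map i p s \<gamma> \<otimes>\<^bsub>ly_Aut G \<times>\<times> ly_Aut H\<^esub> K_map i p s \<delta>"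
    using K_map_comp[OF \<gamma> \<delta> K K'] by (simp add: K K')
qed

lemma carrier_Aut_h_g:
  "carrier (Aut_h_g E i p s) = kernel (Aut_h E i) (ly_Aut G \<times>\<times> ly_Aut H) (K_map i p s)"
  by (auto simp: Aut_h_g_def kernel_def)

lemma group_hom_inclusion: "group_hom (Aut_h_g E i p s) (Aut_h E i) (\<lambda>\<gamma>. \<gamma>)"
proof -
  interpret A: group "Aut_h E i" by (rule group_Aut_h)
  interpret K: group_hom "Aut_h E i" "ly_Aut G \<times>\<times> ly_Aut H" "K_map i p s"
    by (rule group_hom_K_map)
  have eq: "Aut_h_g E i p s
      = (Aut_h E i)\<lparr>carrier := kernel (Aut_h E i) (ly_Aut G \<times>\<times> ly_Aut H) (K_map i p s)\<rparr>"
    unfolding carrier_Aut_h_g[symmetric] by (simp add: Aut_h_g_def)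
  have "group (Aut_h_g E i p s)"
    unfolding eq by (rule A.subgroup_imp_group[OF K.subgroup_kernel])
  moreover have "(\<lambda>\<gamma>. \<gamma>) \<in> hom (Aut_h_g E i p s) (Aut_h E i)"
    by (rule homI) (auto simp: eq kernel_def)
  ultimately show ?thesis
    by (simp add: group_hom_def group_hom_axioms_def group_Aut_h)
qed

lemma twist_in_cocycles:
  assumes "\<alpha> \<in> carrier (ly_Aut G)" "\<beta> \<in> carrier (ly_Aut H)"
  shows "twist \<alpha> \<beta> (induced_cocycle E G i s) \<in> nab_cocycles G H"
  unfolding twist_induced_cocycle[OF assms]
  by (rule split_extension.induced_in_cocycles[OF twisted_extension[OF assms]])

lemma Wells_map_in_H23:
  "Wells_map H E G i s \<in> carrier (ly_Aut G \<times>\<times> ly_Aut H) \<rightarrow> H23_nab G H"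
  by (auto simp: Wells_map_def nab_class_def H23_nab_def intro!: quotientI twist_in_cocycles)

lemma Wells_kernel_eq:
  "Wells_kernel H E G i s = {ab \<in> carrier (ly_Aut G \<times>\<times> ly_Aut H).
     Wells_map H E G i s ab = nab_class G H (induced_cocycle E G i s)}"
proof -
  have "nab_class G H c1 = nab_class G H c2 \<longleftrightarrow> nab_equivalent G H c1 c2"
    if "c1 \<in> nab_cocycles G H" "c2 \<in> nab_cocycles G H" for c1 c2
    using eq_equiv_class_iff[OF equiv_nab_equiv_rel that] that
      G.lie_yamaguti_axioms H.lie_yamaguti_axioms
    by (simp add: nab_class_def nab_equiv_rel_def)
  from this[OF twist_in_cocycles induced_in_cocycles] show ?thesis
    by (auto simp: Wells_kernel_def Wells_map_def)
qed

lemma K_map_in_Wells_kernel: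
  assumes \<gamma>: "\<gamma> \<in> carrier (Aut_h E i)"
  shows "K_map i p s \<gamma> \<in> Wells_kernel H E G i s"
proof -
  obtain \<alpha> \<beta> where K: "K_map i p s \<gamma> = (\<alpha>, \<beta>)" by (meson surj_pair)
  note aut = K_map_carrier[OF \<gamma> K]
  note it = K_map_intertwines[OF \<gamma> K]
  have \<gamma>_hom: "\<gamma> \<in> ly_hom E E" using \<gamma> by (simp add: carrier_Aut_h carrier_ly_Aut)
  \<comment> \<open>\<open>\<gamma>\<close> carries the section of the twisted extension to this section of the original one\<close>
  let ?s = "\<gamma> \<circ> s \<circ> inv_into UNIV \<alpha>"
  have inv: "\<alpha> (inv_into UNIV \<alpha> x) = x" "\<beta> (inv_into UNIV \<beta> a) = a" for x a
    using aut by (simp_all add: carrier_ly_Aut bij_def surj_f_inv_f)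
  have "Vector_Spaces.linear (scl G) (scl G) (inv_into UNIV \<alpha>)"
    using inv_into_in_ly_Aut[OF aut(1)] by (auto simp: carrier_ly_Aut dest: ly_homD)
  then have sec': "ly_section E G p ?s"
    using s_linear ly_homD(1)[OF \<gamma>_hom] by (simp add: ly_section_def linear_iff_all fun_eq_iff it inv)
  then obtain \<phi> where \<phi>: "Vector_Spaces.linear (scl G) (scl H) \<phi>" "\<And>x. ?s x = s x - i (\<phi> x)"
    using section_differs_by_linear by blast
  have s': "?s = (\<lambda>x. s x - i (\<phi> x))" using \<phi>(2) by auto
  have "twist \<alpha> \<beta> (induced_cocycle E G i s) = induced_cocycle E G i ?s"
    unfolding twist_induced_cocycle[OF aut]
  proof (rule induced_cocycle_iso[OF twisted_extension[OF aut] _ \<gamma>_hom])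
    show "split_extension H E G i p ?s"
      unfolding s' by (rule shifted_section[OF \<phi>(1)])
  qed (simp_all add: it inv)
  also have "\<dots> = nab_shift G H \<phi> (induced_cocycle E G i s)"
    unfolding s' by (rule induced_cocycle_shifted_section[OF \<phi>(1)])
  finally show ?thesis
    using \<phi>(1) aut by (auto simp: Wells_kernel_def K nab_equivalent_iff_shift)
qed

lemma Wells_kernel_lifts:
  assumes "(\<alpha>, \<beta>) \<in> Wells_kernel H E G i s"
  shows "\<exists>\<gamma>\<in>carrier (Aut_h E i). K_map i p s \<gamma> = (\<alpha>, \<beta>)"
proof -
  from assms have aut: "\<alpha> \<in> carrier (ly_Aut G)" "\<beta> \<in> carrier (ly_Aut H)"
    and equivalent: "nab_equivalent G H (twist \<alpha> \<beta> (induced_cocycle E G i s)) (induced_cocycle E G i s)"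
    by (auto simp: Wells_kernel_def)
  have inv: "inv_into UNIV \<alpha> (\<alpha> x) = x" "inv_into UNIV \<beta> (\<beta> a) = a" for x a
    using aut by (simp_all add: carrier_ly_Aut bij_def)
  from equivalent obtain \<phi> where \<phi>: "Vector_Spaces.linear (scl G) (scl H) \<phi>"
    and "twist \<alpha> \<beta> (induced_cocycle E G i s) = nab_shift G H \<phi> (induced_cocycle E G i s)"
    by (auto simp: nab_equivalent_iff_shift)
  then have "induced_cocycle E G (i \<circ> inv_into UNIV \<beta>) (s \<circ> inv_into UNIV \<alpha>)
      = induced_cocycle E G i (\<lambda>x. s x - i (\<phi> x))"
    by (simp add: twist_induced_cocycle[OF aut] induced_cocycle_shifted_section)
  from iso_of_induced_cocycle_eq[OF twisted_extension[OF aut] shifted_section[OF \<phi>] this]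
  obtain \<gamma> where \<gamma>: "\<gamma> \<in> ly_hom E E" "bij \<gamma>"
    and \<gamma>s': "\<And>x. \<gamma> ((s \<circ> inv_into UNIV \<alpha>) x) = s x - i (\<phi> x)"
    and \<gamma>i': "\<And>a. \<gamma> ((i \<circ> inv_into UNIV \<beta>) a) = i a"
    by blast
  have \<gamma>s: "\<gamma> (s x) = s (\<alpha> x) - i (\<phi> (\<alpha> x))" and \<gamma>i: "\<gamma> (i a) = i (\<beta> a)" for x a
    using \<gamma>s'[of "\<alpha> x"] \<gamma>i'[of "\<beta> a"] by (simp_all add: inv)
  have "range \<beta> = UNIV" using aut by (simp add: carrier_ly_Aut bij_def)
  moreover have "\<gamma> ` range i = i ` range \<beta>"
    by (simp add: image_image \<gamma>i)
  ultimately have "\<gamma> ` range i = range i" by simp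
  then have "\<gamma> \<in> carrier (Aut_h E i)"
    using \<gamma> by (simp add: carrier_Aut_h carrier_ly_Aut)
  moreover have "K_map i p s \<gamma> = (\<alpha>, \<beta>)"
    using i_inj by (simp add: K_map_def fun_eq_iff \<gamma>s \<gamma>i p_simps)
  ultimately show ?thesis by blast
qed

end

theorem theorem6p3:
  fixes H :: "('k::field, 'h::ab_group_add) ly_struct"
    and E :: "('k, 'e::ab_group_add) ly_struct"
    and G :: "('k, 'g::ab_group_add) ly_struct"
    and i :: "'h \<Rightarrow> 'e" and p :: "'e \<Rightarrow> 'g" and s :: "'g \<Rightarrow> 'e"
  assumes "ly_extension H E G i p"
    and "ly_section E G p s"
  shows "group_hom (Aut_h_g E i p s) (Aut_h E i) (\<lambda>\<gamma>. \<gamma>)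
    \<and> inj_on (\<lambda>\<gamma>. \<gamma>) (carrier (Aut_h_g E i p s))
    \<and> group_hom (Aut_h E i) (ly_Aut G \<times>\<times> ly_Aut H) (K_map i p s)
    \<and> (\<lambda>\<gamma>. \<gamma>) ` carrier (Aut_h_g E i p s)
        = kernel (Aut_h E i) (ly_Aut G \<times>\<times> ly_Aut H) (K_map i p s)
    \<and> Wells_map H E G i s \<in> carrier (ly_Aut G \<times>\<times> ly_Aut H) \<rightarrow> H23_nab G H
    \<and> Wells_kernel H E G i s
        = {ab \<in> carrier (ly_Aut G \<times>\<times> ly_Aut H).
             Wells_map H E G i s ab = nab_class G H (induced_cocycle E G i s)}
    \<and> K_map i p s ` carrier (Aut_h E i) = Wells_kernel H E G i s"
proof -
  interpret split_extension H E G i p s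
    using assms by (intro split_extension.intro split_extension_axioms.intro)
  have "K_map i p s ` carrier (Aut_h E i) = Wells_kernel H E G i s"
    using K_map_in_Wells_kernel Wells_kernel_lifts by force
  then show ?thesis
    using group_hom_inclusion group_hom_K_map carrier_Aut_h_g Wells_map_in_H23 Wells_kernel_eq
    by auto
qed

end
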